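(* Let $n\ge2$ be an integer, $0<s<\frac12$, and let $\Omega\subset\mathbb{R}^n$ be a measurable Lipschitz set of finite measure, $\mathcal{L}^n(\Omega)<\infty$. Assume that $\Omega$ satisfies the decay condition in one direction and that for every $K>0$ the set $\Omega\cap\{|x_1|<K\}$ is bounded. Then $P^1_{n,s}(\Omega)=0$.
   Context: Write $x=(x_1,x')\in\mathbb{R}\times\mathbb{R}^{n-1}$ and $\{x_1=R\}=\{(x_1,x')\in\mathbb{R}^n: x_1=R\}$; $\mathcal{L}^n$ is Lebesgue measure and $\mathcal{H}^{n-1}$ is $(n-1)$-dimensional Hausdorff measure. A Lipschitz set is an open set whose boundary is locally (up to a rigid motion) the graph of a Lipschitz function, with the set lying locally on one side of the graph. Decay condition in one direction: $\Omega\subset\mathbb{R}^n$ satisfies it if for both $\Omega_+=\Omega$ and $\Omega_-=\{(-x_1,x'):(x_1,x')\in\Omega\}$ the following holds: there exists a function $h:[0,\infty)\to[0,\infty)$ such that $\mathcal{H}^{n-1}(\Omega_\pm\cap\{x_1=R\})\le C\,h(R)$ for all $R>0$, for some constant $C=C(\Omega)\ge0$, and there exist $a>0$ and an infinite sequence $\{R_k\}_{k\in\mathbb{N}}$ such that $\lim_{k\to\infty}R_k=\infty$, $\lim_{k\to\infty}h(R_k)=0$, and $h(R_k+\eta)\le h(R_k)$ for all $k$ and all $\eta\in[0,a)$. For $0<s<1$ set $C_{n,s}=\dfrac{s\,2^{2s}\,\Gamma\left(\frac{n+2s}{2}\right)}{\pi^{n/2}\,\Gamma(1-s)}$. For an open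 set $\Omega\subset\mathbb{R}^n$ let $[u]_{s,2,\Omega}=\left(\frac{C_{n,s}}{2}\int_\Omega\int_\Omega\frac{|u(x)-u(y)|^2}{|x-y|^{n+2s}}\,dx\,dy\right)^{1/2}$, and let $W^{s,2}_0(\Omega)$ be the closure of $C_c^\infty(\Omega)$ in the norm $\left(\|u\|_{L^2(\Omega)}^2+[u]_{s,2,\Omega}^2\right)^{1/2}$. Define $$P^1_{n,s}(\Omega)=\inf_{u\in W^{s,2}_0(\Omega),\,u\ne0}\frac{[u]_{s,2,\Omega}^2}{\int_\Omega u^2}$$ ($\Omega$ is understood to be nonempty). *)

theory Defs
  imports "HOL-Analysis.Analysis"
begin

text \<open>
  Euclidean space of dimension \<open>n \<ge> 2\<close> with points written \<open>(x\<^sub>1, x')\<close> is the type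
  \<open>real \<times> 'b\<close> with \<open>'b\<close> a Euclidean space of dimension \<open>n - 1\<close>; its library norm is the Euclidean
  one. Notions that do not single out a coordinate are stated for an arbitrary Euclidean space
  \<open>'a\<close>, with \<open>n = DIM('a)\<close>.
\<close>

text \<open>
  Normalised so that it agrees with Lebesgue measure when \<open>d\<close> is the dimension of the space. The
  empty set is treated separately because \<open>0 ^ 0 = 1\<close>, which for \<open>d = 0\<close> is the right weight for
  singletons only.
\<close>

definition hausdorff_weight :: "nat \<Rightarrow> 'a::metric_space set \<Rightarrow> ennreal" where
  "hausdorff_weight d E =
     (if E = {} then 0 else ennreal (unit_ball_vol (real d) * (diameter E / 2) ^ d))"

definition hausdorff_content :: "nat \<Rightarrow> real \<Rightarrow> 'a::metric_space set \<Rightarrow> ennreal" where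
  "hausdorff_content d \<delta> S =
     (INF E \<in> {E :: nat \<Rightarrow> 'a set. S \<subseteq> (\<Union>i. E i) \<and> (\<forall>i. bounded (E i) \<and> diameter (E i) \<le> \<delta>)}.
        \<Sum>i. hausdorff_weight d (E i))"

definition hausdorff_measure :: "nat \<Rightarrow> 'a::metric_space set \<Rightarrow> ennreal" where
  "hausdorff_measure d S = (SUP \<delta> \<in> {0<..}. hausdorff_content d \<delta> S)"

text \<open>
  The rigid motion is \<open>x \<mapsto> A x + b\<close>. Reflections are admitted, so it suffices to ask that the
  set lie below the graph.
\<close>

definition lipschitz_set :: "(real \<times> 'b::euclidean_space) set \<Rightarrow> bool" where
  "lipschitz_set \<Omega> \<longleftrightarrow> open \<Omega> \<and>
     (\<forall>p \<in> frontier \<Omega>. \<exists>r > 0. \<exists>A b g L.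
        orthogonal_transformation A \<and> L-lipschitz_on UNIV (g :: 'b \<Rightarrow> real) \<and>
        frontier \<Omega> \<inter> ball p r = {x \<in> ball p r. fst (A x + b) = g (snd (A x + b))} \<and>
        \<Omega> \<inter> ball p r = {x \<in> ball p r. fst (A x + b) < g (snd (A x + b))})"

definition decay_forward :: "(real \<times> 'b::euclidean_space) set \<Rightarrow> bool" where
  "decay_forward \<Omega> \<longleftrightarrow>
     (\<exists>h :: real \<Rightarrow> real.
        (\<forall>t \<ge> 0. 0 \<le> h t) \<and>
        (\<exists>C \<ge> 0. \<forall>t > 0.
           hausdorff_measure (DIM(real \<times> 'b) - 1) (\<Omega> \<inter> {x. fst x = t}) \<le> ennreal (C * h t)) \<and>
        (\<exists>a > 0. \<exists>R :: nat \<Rightarrow> real.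
           (\<forall>k. 0 \<le> R k) \<and>
           filterlim R at_top sequentially \<and>
           (\<lambda>k. h (R k)) \<longlonglongrightarrow> 0 \<and>
           (\<forall>k. \<forall>\<eta> \<in> {0..<a}. h (R k + \<eta>) \<le> h (R k))))"

definition decay_one_direction :: "(real \<times> 'b::euclidean_space) set \<Rightarrow> bool" where
  "decay_one_direction \<Omega> \<longleftrightarrow>
     decay_forward \<Omega> \<and> decay_forward ((\<lambda>(x\<^sub>1, x'). (- x\<^sub>1, x')) ` \<Omega>)"

fun Ck_function :: "nat \<Rightarrow> ('a::euclidean_space \<Rightarrow> real) \<Rightarrow> bool" where
  "Ck_function 0 f \<longleftrightarrow> continuous_on UNIV f"
| "Ck_function (Suc k) f \<longleftrightarrow>
     (\<forall>x. f differentiable (at x)) \<and> (\<forall>v. Ck_function k (\<lambda>x. frechet_derivative f (at x) v))"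

text \<open>Elements of \<open>C\<^sub>c\<^sup>\<infinity>(\<Omega>)\<close> are taken to be extended by zero to the whole space.\<close>

definition test_functions :: "'a::euclidean_space set \<Rightarrow> ('a \<Rightarrow> real) set" where
  "test_functions \<Omega> =
     {f. (\<forall>k. Ck_function k f) \<and>
         compact (closure {x. f x \<noteq> 0}) \<and> closure {x. f x \<noteq> 0} \<subseteq> \<Omega>}"

text \<open>
  Seminorms and norms take values in \<open>[0, \<infinity>]\<close>, so that no integrability convention for the
  Bochner integral enters.
\<close>

definition ennreal_sqrt :: "ennreal \<Rightarrow> ennreal" where
  "ennreal_sqrt x = (if x = \<infinity> then \<infinity> else ennreal (sqrt (enn2real x)))"

lemma ennreal_sqrt_power2: "ennreal_sqrt x ^ 2 = x"
  by (cases x) (auto simp: ennreal_sqrt_def ennreal_power power2_eq_square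
      ennreal_mult_top simp flip: ennreal_mult)

definition frac_const :: "nat \<Rightarrow> real \<Rightarrow> real" where
  "frac_const n s =
     s * 2 powr (2 * s) * Gamma ((real n + 2 * s) / 2) / (pi powr (real n / 2) * Gamma (1 - s))"

definition gagliardo_seminorm ::
  "real \<Rightarrow> 'a::euclidean_space set \<Rightarrow> ('a \<Rightarrow> real) \<Rightarrow> ennreal" where
  "gagliardo_seminorm s \<Omega> u =
     ennreal_sqrt (ennreal (frac_const DIM('a) s / 2) *
       (\<integral>\<^sup>+y\<in>\<Omega>. (\<integral>\<^sup>+x\<in>\<Omega>.
          ennreal (\<bar>u x - u y\<bar>\<^sup>2 / norm (x - y) powr (real DIM('a) + 2 * s)) \<partial>lebesgue) \<partial>lebesgue))"

definition frac_sobolev_norm ::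
  "real \<Rightarrow> 'a::euclidean_space set \<Rightarrow> ('a \<Rightarrow> real) \<Rightarrow> ennreal" where
  "frac_sobolev_norm s \<Omega> u =
     ennreal_sqrt ((\<integral>\<^sup>+x\<in>\<Omega>. ennreal ((u x)\<^sup>2) \<partial>lebesgue) + (gagliardo_seminorm s \<Omega> u)\<^sup>2)"

text \<open>
  Elements are representatives of almost-everywhere classes on \<open>\<Omega>\<close>; their values outside \<open>\<Omega>\<close> are
  irrelevant. The norm of an element is automatically finite, being at finite distance from a
  test function.
\<close>

definition frac_sobolev_0 ::
  "real \<Rightarrow> 'a::euclidean_space set \<Rightarrow> ('a \<Rightarrow> real) set" where
  "frac_sobolev_0 s \<Omega> =
     {u \<in> borel_measurable (lebesgue_on \<Omega>).
        \<exists>\<phi> :: nat \<Rightarrow> 'a \<Rightarrow> real. (\<forall>k. \<phi> k \<in> test_functions \<Omega>) \<and>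
          (\<lambda>k. frac_sobolev_norm s \<Omega> (\<lambda>x. \<phi> k x - u x)) \<longlonglongrightarrow> 0}"

definition poincare_const :: "real \<Rightarrow> 'a::euclidean_space set \<Rightarrow> ennreal" where
  "poincare_const s \<Omega> =
     (INF u \<in> {u \<in> frac_sobolev_0 s \<Omega>. \<not> (AE x in lebesgue_on \<Omega>. u x = 0)}.
        (gagliardo_seminorm s \<Omega> u)\<^sup>2 / (\<integral>\<^sup>+x\<in>\<Omega>. ennreal ((u x)\<^sup>2) \<partial>lebesgue))"

end

theory Submission
  imports Defs
begin

text \<open>
  Cut \<open>\<Omega>\<close> down to the bounded set \<open>D = \<Omega> \<inter> {-S < x\<^sub>1 < R}\<close> and test with a smooth function that is
  \<open>1\<close> on \<open>D\<close> except in a \<open>\<delta>\<close>-neighbourhood of the frontier of \<open>D\<close>. Since that frontier consists of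
  compact pieces of Lipschitz graphs, the layer has measure \<open>O(\<delta>)\<close>, and the pairs meeting it
  contribute \<open>O(\<delta> \<sqdot> \<delta> powr (-2s))\<close> to the energy, which vanishes as \<open>\<delta> \<rightarrow> 0\<close> because \<open>2s < 1\<close>. The
  remaining pairs join \<open>D\<close> to \<open>\<Omega> - D\<close>; integrating the kernel over \<open>D\<close> first leaves
  \<open>\<integral>\<^bsub>t > R\<^esub> (t - R) powr (-2s) \<sqdot> |\<Omega> \<inter> {x\<^sub>1 = t}| dt\<close> and its mirror image. Splitting
  at \<open>t = R + a\<close>, this is at most a multiple of \<open>h R\<close> plus a multiple of the measure of the tail of \<open>\<Omega>\<close>, and both tend to
  \<open>0\<close> along the sequence of the decay condition, while the mass of the test function stays bounded
  below.
\<close>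

subsection \<open>Smooth functions\<close>

text \<open>The two error terms are made small in a fixed order: the far interaction by the choice
  of \<open>D\<close>, and only then the layer by the choice of \<delta>, because the constant in
  the O(\<delta>) bound depends on \<open>D\<close>. The cutoff must therefore have Lipschitz
  constant C / \<delta> with C independent of \<delta>; a partition of unity on a lattice of mesh
  proportional to \<delta> provides this together with compact support. The cost of the layer comes
  from scaling: squared differences of the cutoff are at most min 1 ((C |z| / \<delta>)^2), and
  dividing by |z|^(n + 2s) leaves a kernel that is integrable at the origin because s < 1 and at
  infinity because s > 0, with total mass of order \<delta> powr (-2s). The cuts may create corners,
  so \<open>D\<close> need not be a Lipschitz set. Only the volume of neighbourhoods of its frontier
  is used, and a linear bound on that volume passes to finite unions. Cutting exactly at a radius of
  the decay sequence matters because the weight (t - R) powr (-2s) blows up at the cut, and just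
  beyond such a radius the slices are uniformly controlled.\<close>

lemma Ck_function_SucD: "Ck_function (Suc k) f \<Longrightarrow> Ck_function k f"
proof (induction k arbitrary: f)
  case 0
  then show ?case
    by (auto intro!: differentiable_imp_continuous_on simp: differentiable_on_def)
next
  case (Suc k)
  show ?case
    unfolding Ck_function.simps(2)
  proof (intro conjI allI)
    show "f differentiable at x" for x using Suc.prems by simp
    show "Ck_function k (\<lambda>x. frechet_derivative f (at x) v)" for v
      using Suc.prems Ck_function.simps(2)[of "Suc k" f] by (intro Suc.IH) blast
  qed
qed

text \<open>The recursion is stated with the choice term \<open>frechet_derivative\<close>;
  uniqueness of the derivative lets the closure proofs below supply an explicit one instead.\<close>

lemma Ck_function_SucI:
  assumes "\<And>x. (f has_derivative f' x) (at x)" "\<And>v. Ck_function k (\<lambda>x. f' x v)"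
  shows "Ck_function (Suc k) f"
proof -
  have "frechet_derivative f (at x) = f' x" for x
    using frechet_derivative_at[OF assms(1)] by simp
  then show ?thesis using assms by (auto simp: differentiable_def)
qed

lemma Ck_function_SucE:
  assumes "Ck_function (Suc k) f"
  obtains f' where "\<And>x. (f has_derivative f' x) (at x)" "\<And>v. Ck_function k (\<lambda>x. f' x v)"
  using assms that[of "\<lambda>x. frechet_derivative f (at x)"] by (auto simp: frechet_derivative_works)

lemma Ck_function_const: "Ck_function k (\<lambda>x. c)"
  by (induction k arbitrary: c) (simp, rule Ck_function_SucI[OF has_derivative_const], simp)

lemma Ck_function_affine: "Ck_function k (\<lambda>x. x \<bullet> b * c + d)"
proof (cases k)
  case (Suc j)
  have "((\<lambda>x. x \<bullet> b * c + d) has_derivative (\<lambda>v. v \<bullet> b * c)) (at x)" for x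
    by (auto intro!: derivative_eq_intros)
  then show ?thesis
    unfolding Suc by (rule Ck_function_SucI) (rule Ck_function_const)
qed (auto intro!: continuous_intros)

lemma Ck_function_add: "Ck_function k f \<Longrightarrow> Ck_function k g \<Longrightarrow> Ck_function k (\<lambda>x. f x + g x)"
proof (induction k arbitrary: f g)
  case (Suc k)
  obtain f' where f: "\<And>x. (f has_derivative f' x) (at x)" "\<And>v. Ck_function k (\<lambda>x. f' x v)"
    using Suc.prems(1) by (rule Ck_function_SucE) blast
  obtain g' where g: "\<And>x. (g has_derivative g' x) (at x)" "\<And>v. Ck_function k (\<lambda>x. g' x v)"
    using Suc.prems(2) by (rule Ck_function_SucE) blast
  show ?case
    by (rule Ck_function_SucI[OF has_derivative_add[OF f(1) g(1)]]) (intro Suc.IH f g)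
qed (auto intro: continuous_intros)

text \<open>The Leibniz rule brings back the undifferentiated factors, which
  \<open>Ck_function_SucD\<close> supplies at order \<open>k\<close>.\<close>

lemma Ck_function_mult: "Ck_function k f \<Longrightarrow> Ck_function k g \<Longrightarrow> Ck_function k (\<lambda>x. f x * g x)"
proof (induction k arbitrary: f g)
  case (Suc k)
  obtain f' where f: "\<And>x. (f has_derivative f' x) (at x)" "\<And>v. Ck_function k (\<lambda>x. f' x v)"
    using Suc.prems(1) by (rule Ck_function_SucE) blast
  obtain g' where g: "\<And>x. (g has_derivative g' x) (at x)" "\<And>v. Ck_function k (\<lambda>x. g' x v)"
    using Suc.prems(2) by (rule Ck_function_SucE) blast
  show ?case
    by (rule Ck_function_SucI[OF has_derivative_mult[OF f(1) g(1)]])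
      (intro Ck_function_add Suc.IH f g Suc.prems[THEN Ck_function_SucD])
qed (auto intro: continuous_intros)

lemma Ck_function_sum: "(\<And>i. i \<in> I \<Longrightarrow> Ck_function k (f i)) \<Longrightarrow> Ck_function k (\<lambda>x. \<Sum>i\<in>I. f i x)"
  by (induction I rule: infinite_finite_induct) (auto intro: Ck_function_const Ck_function_add)

lemma Ck_function_prod: "(\<And>i. i \<in> I \<Longrightarrow> Ck_function k (f i)) \<Longrightarrow> Ck_function k (\<lambda>x. \<Prod>i\<in>I. f i x)"
  by (induction I rule: infinite_finite_induct) (auto intro: Ck_function_const Ck_function_mult)

lemma Ck_function_inverse:
  "Ck_function k f \<Longrightarrow> (\<And>x. f x \<noteq> 0) \<Longrightarrow> Ck_function k (\<lambda>x. inverse (f x))"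
proof (induction k)
  case (Suc k)
  obtain f' where f: "\<And>x. (f has_derivative f' x) (at x)" "\<And>v. Ck_function k (\<lambda>x. f' x v)"
    using Suc.prems(1) by (rule Ck_function_SucE) blast
  have "Ck_function k (\<lambda>x. inverse (f x))"
    by (intro Suc.IH Suc.prems Ck_function_SucD)
  then have "Ck_function k (\<lambda>x. (-1) * (inverse (f x) * f' x v * inverse (f x)))" for v
    by (intro Ck_function_mult Ck_function_const f)
  then show ?case
    by (intro Ck_function_SucI[OF Deriv.has_derivative_inverse[OF Suc.prems(2) f(1)]]) auto
qed (auto intro!: continuous_intros)

text \<open>Since the outer function has a scalar argument, linearity turns
  \<open>g' (f x) (f' x v)\<close> into \<open>f' x v * g' (f x) 1\<close>. This is a product with
  another composition, so the induction closes.\<close>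

lemma Ck_function_compose:
  fixes g :: "real \<Rightarrow> real"
  shows "Ck_function k f \<Longrightarrow> Ck_function k g \<Longrightarrow> Ck_function k (\<lambda>x. g (f x))"
proof (induction k arbitrary: f g)
  case 0
  then show ?case by (auto intro: continuous_on_compose2)
next
  case (Suc k)
  obtain f' where f: "\<And>x. (f has_derivative f' x) (at x)" "\<And>v. Ck_function k (\<lambda>x. f' x v)"
    using Suc.prems(1) by (rule Ck_function_SucE) blast
  obtain g' where g: "\<And>x. (g has_derivative g' x) (at x)" "\<And>v. Ck_function k (\<lambda>x. g' x v)"
    using Suc.prems(2) by (rule Ck_function_SucE) blast
  have lin: "g' y w = w * g' y 1" for y w
    using linear_scale[OF has_derivative_linear[OF g(1)[of y]], of w 1] by simp
  have "g' (f x) (f' x v) = f' x v * g' (f x) 1" for x v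
    by (rule lin)
  then have deriv: "((\<lambda>x. g (f x)) has_derivative (\<lambda>v. f' x v * g' (f x) 1)) (at x)" for x
    using has_derivative_compose[OF f(1)[of x] g(1)[of "f x"]] by simp
  have "Ck_function k (\<lambda>x. g' (f x) 1)"
    using Suc.IH[of f "\<lambda>y. g' y 1"] Suc.prems(1)[THEN Ck_function_SucD] g(2)[of 1] by blast
  then have "Ck_function k (\<lambda>x. f' x v * g' (f x) 1)" for v
    using Ck_function_mult[OF f(2)[of v]] by blast
  with deriv show ?case
    using Ck_function_SucI[of "\<lambda>x. g (f x)" "\<lambda>x v. f' x v * g' (f x) 1" k] by blast
qed

section \<open>The flat function exp (- 1 / t) and a smooth step\<close>

definition flat_exp :: "real poly \<Rightarrow> real \<Rightarrow> real" where
  "flat_exp p t = (if t > 0 then poly p (inverse t) * exp (- inverse t) else 0)"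

lemma poly_exp_minus_at_top: "((\<lambda>t. poly p t * exp (- t)) \<longlongrightarrow> (0::real)) at_top"
proof -
  have "((\<lambda>t. \<Sum>i\<le>degree p. coeff p i * (t ^ i / exp t)) \<longlongrightarrow> (\<Sum>i\<le>degree p. coeff p i * 0)) at_top"
    by (intro tendsto_intros tendsto_power_div_exp_0)
  then show ?thesis
    by (simp add: poly_altdef exp_minus sum_distrib_right divide_inverse mult.assoc)
qed

text \<open>The polynomial prefactor in 1 / t is carried along to make the family closed under
  differentiation: with u = 1 / t, the derivative of p(u) exp(-u) with respect to t is u^2 (p(u) -
  p'(u)) exp(-u), and \<open>[:0, 0, 1:]\<close> is u^2.\<close>

lemma flat_exp_has_real_derivative:
  "(flat_exp p has_real_derivative flat_exp ([:0, 0, 1:] * (p - pderiv p)) t) (at t)"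
proof -
  consider "t > 0" | "t < 0" | "t = 0" by linarith
  then show ?thesis
  proof cases
    case 1
    have "((\<lambda>t. poly p (inverse t) * exp (- inverse t)) has_real_derivative
        flat_exp ([:0, 0, 1:] * (p - pderiv p)) t) (at t)"
      using 1 by (auto intro!: derivative_eq_intros poly_DERIV[THEN DERIV_chain2]
          simp: flat_exp_def field_simps power2_eq_square)
    then show ?thesis
      using 1 by (elim DERIV_cong_ev[THEN iffD1, rotated -1])
        (auto simp: flat_exp_def intro: eventually_mono[OF eventually_gt_at_top] eventually_mono[OF
            order_tendstoD(1)[OF tendsto_ident_at]]
          eventually_nhds_in_open[of "{0<..}" t, THEN eventually_mono])
  next
    case 2
    have "((\<lambda>t. 0) has_real_derivative flat_exp ([:0, 0, 1:] * (p - pderiv p)) t) (at t)"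
      using 2 by (simp add: flat_exp_def)
    then show ?thesis
      using 2 by (elim DERIV_cong_ev[THEN iffD1, rotated -1])
        (auto simp: flat_exp_def intro: eventually_nhds_in_open[of "{..<0}" t, THEN
            eventually_mono])
  next
    case 3
    \<comment> \<open>\<open>pCons 0 p\<close> is p times the variable, which absorbs the factor 1 /
      h of the difference quotient at 0.\<close>
    have "((\<lambda>h. poly (pCons 0 p) (inverse h) * exp (- inverse h)) \<longlongrightarrow> 0) (at_right (0::real))"
      by (rule filterlim_compose[OF poly_exp_minus_at_top filterlim_inverse_at_top_right])
    then have "((\<lambda>h. flat_exp p h / h) \<longlongrightarrow> 0) (at_right 0)"
      by (rule Lim_transform_eventually)
        (auto simp: flat_exp_def eventually_at_right_less field_simps intro: eventually_mono[OF
            eventually_at_right_less])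
    moreover have "((\<lambda>h. flat_exp p h / h) \<longlongrightarrow> 0) (at_left 0)"
      by (rule Lim_transform_eventually[OF tendsto_const])
        (auto simp: flat_exp_def eventually_at_filter)
    ultimately have "((\<lambda>h. flat_exp p h / h) \<longlongrightarrow> 0) (at 0)"
      by (simp add: filterlim_at_split)
    then show ?thesis
      using 3 by (simp add: DERIV_def flat_exp_def)
  qed
qed

lemma Ck_function_flat_exp: "Ck_function k (flat_exp p)"
proof (induction k arbitrary: p)
  case 0
  then show ?case
    using flat_exp_has_real_derivative DERIV_isCont continuous_at_imp_continuous_on
        by (metis Ck_function.simps(1))
next
  case (Suc k)
  show ?case
    by (rule Ck_function_SucI[OF flat_exp_has_real_derivative[unfolded has_field_derivative_def]])
      (intro Ck_function_mult Suc Ck_function_const)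
qed

definition smooth_step :: "real \<Rightarrow> real" where
  "smooth_step t = flat_exp 1 t * inverse (flat_exp 1 t + flat_exp 1 (1 - t))"

lemma flat_exp_1_nonneg: "0 \<le> flat_exp 1 t"
  by (simp add: flat_exp_def)

lemma smooth_step_denom_pos: "0 < flat_exp 1 t + flat_exp 1 (1 - t)"
  by (auto simp: flat_exp_def intro: add_pos_pos)

lemma Ck_function_smooth_step: "Ck_function k smooth_step"
proof -
  have "Ck_function k (\<lambda>t. flat_exp 1 (t \<bullet> (1::real) * (-1) + 1))"
    by (intro Ck_function_compose[OF Ck_function_affine Ck_function_flat_exp])
  then have "Ck_function k (\<lambda>t. flat_exp 1 (1 - t))"
    by simp
  then have "Ck_function k (\<lambda>t. flat_exp 1 t * inverse (flat_exp 1 t + flat_exp 1 (1 - t)))"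
    using smooth_step_denom_pos[THEN less_imp_neq]
    by (intro Ck_function_mult Ck_function_inverse Ck_function_add Ck_function_flat_exp) metis+
  then show ?thesis by (simp add: smooth_step_def[abs_def])
qed

lemma smooth_step_eq_0: "t \<le> 0 \<Longrightarrow> smooth_step t = 0"
  by (simp add: smooth_step_def flat_exp_def)

lemma smooth_step_eq_1: "t \<ge> 1 \<Longrightarrow> smooth_step t = 1"
  by (simp add: smooth_step_def flat_exp_def)

lemma flat_exp_1_mono: "s \<le> t \<Longrightarrow> flat_exp 1 s \<le> flat_exp 1 t"
  by (auto simp: flat_exp_def intro: le_imp_inverse_le)

lemma mono_smooth_step: "mono smooth_step"
proof (rule monoI)
  fix s t :: real assume st: "s \<le> t"
  have "flat_exp 1 s * flat_exp 1 (1 - t) \<le> flat_exp 1 t * flat_exp 1 (1 - s)"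
    using st by (intro mult_mono flat_exp_1_mono flat_exp_1_nonneg) auto
  then show "smooth_step s \<le> smooth_step t"
    using smooth_step_denom_pos[of s] smooth_step_denom_pos[of t]
    by (simp add: smooth_step_def divide_inverse[symmetric] divide_simps algebra_simps)
qed

text \<open>The derivative is continuous, hence bounded on \<open>{0..1}\<close>, and it vanishes
  elsewhere because the step is locally constant there.\<close>

lemma smooth_step_lipschitz: "\<exists>L>0. \<forall>s t. \<bar>smooth_step s - smooth_step t\<bar> \<le> L * \<bar>s - t\<bar>"
proof -
  obtain d where d: "\<And>x. (smooth_step has_derivative d x) (at x)" "\<And>v. Ck_function 0 (\<lambda>x. d x v)"
    using Ck_function_smooth_step by (rule Ck_function_SucE) blast
  have lin: "d x v = d x 1 * v" for x v
    using linear_scale[OF has_derivative_linear[OF d(1)[of x]], of v 1] by simp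
  have D: "(smooth_step has_real_derivative d x 1) (at x)" for x
  proof -
    have "d x = (*) (d x 1)" using lin by (intro ext)
    then show ?thesis using d(1)[of x] by (simp add: has_field_derivative_def)
  qed
  have "bounded ((\<lambda>x. d x 1) ` {0..1})"
    using d(2)[of 1] by (intro compact_imp_bounded compact_continuous_image)
      (auto intro: continuous_on_subset)
  then obtain B where B: "B > 0" "\<And>x. x \<in> {0..1} \<Longrightarrow> \<bar>d x 1\<bar> \<le> B"
    unfolding bounded_pos by auto
  have "\<bar>d x 1\<bar> \<le> B" for x
  proof (cases "x \<in> {0..1}")
    case False
    have "d x 1 = 0"
    proof (cases "x < 0")
      case True
      have "(smooth_step has_real_derivative 0) (at x)"
        using True by (intro DERIV_cong_ev[OF refl _ refl, THEN iffD2, OF _ DERIV_const[of 0]])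
          (auto simp: smooth_step_eq_0 intro: eventually_nhds_in_open[of "{..<0}" x, THEN
              eventually_mono])
      then show ?thesis using D DERIV_unique by blast
    next
      case F: False
      have "(smooth_step has_real_derivative 0) (at x)"
        using False F by (intro DERIV_cong_ev[OF refl _ refl, THEN iffD2, OF _ DERIV_const[of 1]])
          (auto simp: smooth_step_eq_1 intro: eventually_nhds_in_open[of "{1<..}" x, THEN
              eventually_mono])
      then show ?thesis using D DERIV_unique by blast
    qed
    then show ?thesis using B by simp
  qed (use B in auto)
  then have "\<bar>smooth_step s - smooth_step t\<bar> \<le> B * \<bar>s - t\<bar>" for s t
    using field_differentiable_bound[of UNIV smooth_step "\<lambda>x. d x 1" B] D by auto
  then show ?thesis using B(1) by blast
qed

subsection \<open>Smooth cutoff functions at scale \<open>\<delta>\<close>\<close>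

text \<open>A difference of shifted steps, chosen so that sums over integer translates telescope:
  the translates form a partition of unity of the line.\<close>

definition unit_hat :: "real \<Rightarrow> real" where
  "unit_hat t = smooth_step (t + 1) - smooth_step t"

lemma Ck_function_unit_hat_affine: "Ck_function k (\<lambda>x. unit_hat (x \<bullet> b * c + d))"
proof -
  have "Ck_function k (\<lambda>x. smooth_step (x \<bullet> b * c + (d + 1)) + (-1) * smooth_step (x \<bullet> b * c + d))"
    by (intro Ck_function_add Ck_function_mult Ck_function_const
        Ck_function_compose[OF Ck_function_affine Ck_function_smooth_step])
  then show ?thesis by (simp add: unit_hat_def add.assoc)
qed

lemma smooth_step_bounds: "0 \<le> smooth_step t" "smooth_step t \<le> 1"
  using monoD[OF mono_smooth_step, of "min t 0" t] monoD[OF mono_smooth_step, of t "max t 1"]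
  by (simp_all add: smooth_step_eq_0 smooth_step_eq_1)

lemma unit_hat_bounds: "0 \<le> unit_hat t" "unit_hat t \<le> 1"
  using monoD[OF mono_smooth_step, of t "t + 1"] smooth_step_bounds[of t] smooth_step_bounds[of "t
      + 1"]
  by (auto simp: unit_hat_def)

lemma unit_hat_nonzeroD: "unit_hat t \<noteq> 0 \<Longrightarrow> \<bar>t\<bar> < 1"
  by (rule ccontr) (auto simp: unit_hat_def smooth_step_eq_0 smooth_step_eq_1 abs_if not_less split:
      if_splits)

lemma sum_unit_hat:
  fixes M :: nat
  shows "(\<Sum>k = - int M..int M. unit_hat (t - of_int k)) =
    smooth_step (t + of_nat M + 1) - smooth_step (t - of_nat M)"
proof (induction M)
  case 0
  then show ?case by (simp add: unit_hat_def)
next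
  case (Suc M)
  have *: "{- int (Suc M)..int (Suc M)} =
      insert (- int (Suc M)) (insert (int (Suc M)) {- int M..int M})"
    by auto
  show ?case
    unfolding * by (simp add: Suc) (simp add: unit_hat_def algebra_simps)
qed

lemma card_unit_hat_support: "card {k::int. unit_hat (t - of_int k) \<noteq> 0} \<le> 2"
  and finite_unit_hat_support: "finite {k::int. unit_hat (t - of_int k) \<noteq> 0}"
proof -
  have *: "{k::int. unit_hat (t - of_int k) \<noteq> 0} \<subseteq> {\<lfloor>t\<rfloor>, \<lfloor>t\<rfloor> + 1}"
  proof
    fix k :: int assume "k \<in> {k. unit_hat (t - of_int k) \<noteq> 0}"
    then have "\<bar>t - of_int k\<bar> < 1" using unit_hat_nonzeroD by blast
    then have "k = \<lfloor>t\<rfloor> \<or> k = \<lfloor>t\<rfloor> + 1" by linarith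
    then show "k \<in> {\<lfloor>t\<rfloor>, \<lfloor>t\<rfloor> + 1}" by simp
  qed
  show "card {k::int. unit_hat (t - of_int k) \<noteq> 0} \<le> 2"
    using card_mono[OF _ *] by simp
  show "finite {k::int. unit_hat (t - of_int k) \<noteq> 0}"
    using * finite_subset by blast
qed

lemma abs_prod_diff_le:
  fixes f g :: "'i \<Rightarrow> real"
  assumes "\<And>i. i \<in> I \<Longrightarrow> \<bar>f i\<bar> \<le> 1" "\<And>i. i \<in> I \<Longrightarrow> \<bar>g i\<bar> \<le> 1"
  shows "\<bar>(\<Prod>i\<in>I. f i) - (\<Prod>i\<in>I. g i)\<bar> \<le> (\<Sum>i\<in>I. \<bar>f i - g i\<bar>)"
  using norm_prod_diff[of I f g] assms by auto

definition lattice_bump :: "real \<Rightarrow> ('a::euclidean_space \<Rightarrow> int) \<Rightarrow> 'a \<Rightarrow> real" where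
  "lattice_bump e j x = (\<Prod>b\<in>Basis. unit_hat (x \<bullet> b * inverse e - of_int (j b)))"

text \<open>The cube of half-side \<open>e\<close> about a lattice point, containing every point
  where the bump is nonzero. It is taken closed so that finite unions of cells are compact.\<close>

definition lattice_cell :: "real \<Rightarrow> ('a::euclidean_space \<Rightarrow> int) \<Rightarrow> 'a set" where
  "lattice_cell e j = cbox (\<Sum>b\<in>Basis. (e * (of_int (j b) - 1)) *\<^sub>R b) (\<Sum>b\<in>Basis. (e * (of_int (j b)
      + 1)) *\<^sub>R b)"

lemma mem_lattice_cell:
  assumes "e > 0"
  shows "x \<in> lattice_cell e j \<longleftrightarrow> (\<forall>b\<in>Basis. \<bar>x \<bullet> b * inverse e - of_int (j b)\<bar> \<le> 1)"
proof -
  have "e * (of_int i - 1) \<le> t \<and> t \<le> e * (of_int i + 1) \<longleftrightarrow> \<bar>t * inverse e - of_int i\<bar> \<le> 1"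
    for t and i :: int
    using assms by (auto simp: field_simps abs_le_iff)
  then show ?thesis by (auto simp: lattice_cell_def mem_box)
qed

lemma lattice_bump_nonzeroD:
  assumes "e > 0" "lattice_bump e j x \<noteq> 0"
  shows "x \<in> lattice_cell e j"
  using assms unit_hat_nonzeroD
  by (force simp: mem_lattice_cell lattice_bump_def intro: less_imp_le)

lemma Ck_function_lattice_bump: "Ck_function k (lattice_bump e j)"
proof -
  have "Ck_function k (\<lambda>x. \<Prod>b\<in>Basis. unit_hat (x \<bullet> b * inverse e + (- of_int (j b))))"
    by (intro Ck_function_prod Ck_function_unit_hat_affine)
  then show ?thesis by (simp add: lattice_bump_def[abs_def])
qed

lemma lattice_bump_nonneg: "0 \<le> lattice_bump e j x"
  by (simp add: lattice_bump_def prod_nonneg unit_hat_bounds)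

lemma sum_lattice_bump:
  fixes x :: "'a::euclidean_space" and M :: nat
  shows "(\<Sum>j\<in>(PiE Basis (\<lambda>_. {- int M..int M})). lattice_bump e j x) =
    (\<Prod>b\<in>Basis. smooth_step (x \<bullet> b * inverse e + of_nat M
        + 1) - smooth_step (x \<bullet> b * inverse e - of_nat M))"
  unfolding lattice_bump_def by (subst prod_sum_PiE[symmetric]) (auto simp: sum_unit_hat)

text \<open>Each coordinate leaves at most two integers. Restricting to
  \<open>extensional Basis\<close> gives each lattice point a single index function; otherwise
  values off the basis would produce infinitely many copies of every bump.\<close>

lemma card_lattice_bump_support:
  fixes x :: "'a::euclidean_space"
  shows "finite {j \<in> extensional Basis. lattice_bump e j x \<noteq> 0}"
    and "card {j \<in> extensional Basis. lattice_bump e j x \<noteq> 0} \<le> 2 ^ DIM('a)"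
proof -
  let ?B = "\<lambda>b. {k::int. unit_hat (x \<bullet> b * inverse e - of_int k) \<noteq> 0}"
  have sub: "{j \<in> extensional Basis. lattice_bump e j x \<noteq> 0} \<subseteq> PiE Basis ?B"
    by (auto simp: lattice_bump_def PiE_def)
  have fin: "finite (PiE (Basis::'a set) ?B)"
    by (intro finite_PiE finite_unit_hat_support) auto
  show "finite {j \<in> extensional Basis. lattice_bump e j x \<noteq> 0}"
    using sub fin finite_subset by blast
  have "card {j \<in> extensional Basis. lattice_bump e j x \<noteq> 0} \<le> card (PiE (Basis::'a set) ?B)"
    by (rule card_mono[OF fin sub])
  also have "\<dots> = (\<Prod>b\<in>(Basis::'a set). card (?B b))"
    by (simp add: card_PiE)
  also have "\<dots> \<le> (\<Prod>b\<in>(Basis::'a set). 2)"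
    by (intro prod_mono) (auto simp: card_unit_hat_support)
  finally show "card {j \<in> extensional Basis. lattice_bump e j x \<noteq> 0} \<le> 2 ^ DIM('a)" by simp
qed

lemma unit_hat_lipschitz: "\<exists>L>0. \<forall>s t. \<bar>unit_hat s - unit_hat t\<bar> \<le> L * \<bar>s - t\<bar>"
proof -
  obtain L where L: "L > 0" "\<And>s t. \<bar>smooth_step s - smooth_step t\<bar> \<le> L * \<bar>s - t\<bar>"
    using smooth_step_lipschitz by blast
  have "\<bar>unit_hat s - unit_hat t\<bar> \<le> 2 * L * \<bar>s - t\<bar>" for s t
    using L(2)[of s t] L(2)[of "s + 1" "t + 1"] unfolding unit_hat_def
        by (simp add: abs_if split: if_splits)
  then show ?thesis using L(1) by (intro exI[of _ "2 * L"]) auto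
qed

text \<open>Only boundedly many bumps are nonzero at a given pair of points, whence a Lipschitz bound
  that does not depend on the number of bumps.\<close>

lemma sum_lattice_bump_lipschitz:
  "\<exists>C>0. \<forall>e>0. \<forall>J x y. finite J \<longrightarrow> J \<subseteq> extensional Basis \<longrightarrow>
     \<bar>(\<Sum>j\<in>J. lattice_bump e j x) - (\<Sum>j\<in>J. lattice_bump e j y)\<bar>
         \<le> C * (norm (x - y :: 'a::euclidean_space) / e)"
proof -
  obtain L where L: "L > 0" "\<And>s t. \<bar>unit_hat s - unit_hat t\<bar> \<le> L * \<bar>s - t\<bar>"
    using unit_hat_lipschitz by blast
  define C where "C = 2 * 2 ^ DIM('a) * (DIM('a) * L)"
  have "\<bar>(\<Sum>j\<in>J. lattice_bump e j x) - (\<Sum>j\<in>J. lattice_bump e j y)\<bar> \<le> C * (norm (x - y) / e)"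
    if e: "e > 0" and J: "finite J" "J \<subseteq> extensional Basis" for e J and x y :: 'a
  proof -
    have bump: "\<bar>lattice_bump e j x - lattice_bump e j y\<bar> \<le> DIM('a) * L * (norm (x - y) / e)" for j
    proof -
      have "\<bar>lattice_bump e j x - lattice_bump e j y\<bar> \<le>
          (\<Sum>b\<in>(Basis::'a set). \<bar>unit_hat (x \<bullet> b * inverse e - of_int (j b)) - unit_hat (y \<bullet> b *
              inverse e - of_int (j b))\<bar>)"
        unfolding lattice_bump_def by (intro abs_prod_diff_le) (simp_all add: unit_hat_bounds)
      also have "\<dots> \<le> (\<Sum>b\<in>(Basis::'a set). L * (norm (x - y) / e))"
      proof (rule sum_mono)
        fix b :: 'a assume b: "b \<in> Basis"
        have "\<bar>unit_hat (x \<bullet> b * inverse e - of_int (j b)) - unit_hat (y \<bullet> b * inverse e - of_int (j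
            b))\<bar>
            \<le> L * \<bar>(x - y) \<bullet> b * inverse e\<bar>"
          using L(2)[of "x \<bullet> b * inverse e - of_int (j b)" "y \<bullet> b * inverse e - of_int (j b)"]
          by (simp add: inner_diff_left left_diff_distrib)
        also have "\<dots> \<le> L * (norm (x - y) / e)"
          using L(1) e Basis_le_norm[OF b, of "x - y"]
          by (simp add: abs_mult divide_inverse mult_right_mono)
        finally show "\<bar>unit_hat (x \<bullet> b * inverse e - of_int (j b)) - unit_hat (y \<bullet> b * inverse e -
            of_int (j b))\<bar>
            \<le> L * (norm (x - y) / e)" .
      qed
      finally show ?thesis by simp
    qed
    define S where "S = (\<lambda>z::'a. {j \<in> extensional Basis. lattice_bump e j z \<noteq> 0})"
    have S: "finite (S z)" "card (S z) \<le> 2 ^ DIM('a)" for z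
      using card_lattice_bump_support[of e z] by (auto simp: S_def)
    have "\<bar>(\<Sum>j\<in>J. lattice_bump e j x) - (\<Sum>j\<in>J. lattice_bump e j y)\<bar>
        \<le> (\<Sum>j\<in>J. \<bar>lattice_bump e j x - lattice_bump e j y\<bar>)"
      by (simp add: sum_subtractf[symmetric])
    also have "\<dots> = (\<Sum>j\<in>J \<inter> (S x \<union> S y). \<bar>lattice_bump e j x - lattice_bump e j y\<bar>)"
      using J by (intro sum.mono_neutral_right) (auto simp: S_def)
    also have "\<dots> \<le> (\<Sum>j\<in>J \<inter> (S x \<union> S y). DIM('a) * L * (norm (x - y) / e))"
      by (intro sum_mono bump)
    also have "\<dots> = real (card (J \<inter> (S x \<union> S y))) * (DIM('a) * L * (norm (x - y) / e))"
      by simp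
    also have "\<dots> \<le> (2 * 2 ^ DIM('a)) * (DIM('a) * L * (norm (x - y) / e))"
    proof (rule mult_right_mono)
      have "card (J \<inter> (S x \<union> S y)) \<le> card (S x \<union> S y)"
        using S by (intro card_mono) auto
      also have "\<dots> \<le> card (S x) + card (S y)" by (rule card_Un_le)
      also have "\<dots> \<le> 2 * 2 ^ DIM('a)" using S(2)[of x] S(2)[of y] by linarith
      finally show "real (card (J \<inter> (S x \<union> S y))) \<le> 2 * 2 ^ DIM('a)"
        using of_nat_mono by fastforce
    qed (use L e in auto)
    finally show ?thesis by (simp add: C_def mult.assoc)
  qed
  moreover have "C > 0" using L by (simp add: C_def)
  ultimately show ?thesis by blast
qed

text \<open>The cutoff is the part of the lattice partition of unity made of bumps whose cells fit
  inside \<open>D\<close>. Omitting nonnegative terms keeps the values in [0, 1]. At a point whose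
  \<delta>-ball lies in \<open>D\<close> no nonzero term is omitted, since every cell containing the
  point fits in that ball.\<close>

lemma smooth_cutoff:
  "\<exists>C>0. \<forall>D::'a::euclidean_space set. \<forall>\<delta>>0. open D \<longrightarrow> bounded D \<longrightarrow>
     (\<exists>\<phi>\<in>test_functions D. (\<forall>x. 0 \<le> \<phi> x \<and> \<phi> x \<le> 1) \<and> (\<forall>x. x \<notin> D \<longrightarrow> \<phi> x = 0) \<and>
        (\<forall>x. ball x \<delta> \<subseteq> D \<longrightarrow> \<phi> x = 1) \<and> (\<forall>x y. \<bar>\<phi> x - \<phi> y\<bar> \<le> C * (norm (x - y) / \<delta>)))"
proof -
  obtain C where C0: "C > 0" and C1: "\<forall>e>0. \<forall>J x y. finite J \<longrightarrow> J \<subseteq> extensional Basis \<longrightarrow>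
     \<bar>(\<Sum>j\<in>J. lattice_bump e j x) - (\<Sum>j\<in>J. lattice_bump e j y)\<bar> \<le> C * (norm (x - y :: 'a) / e)"
    using sum_lattice_bump_lipschitz[where 'a = 'a] by (elim exE conjE)
  note C = C0 C1[rule_format]
  \<comment> \<open>Points of one cell of mesh \<open>e\<close> differ by at most
    \<open>2 * e\<close> in each coordinate, so by at most \<open>2 * DIM('a) * e\<close> in norm;
    the extra 1 makes this strictly less than \<delta> for \<open>e = \<delta> / d\<close>.\<close>
  define d where "d = 2 * real DIM('a) + 1"
  have d: "d > 0" by (simp add: d_def)
  have "\<exists>\<phi>\<in>test_functions D. (\<forall>x. 0 \<le> \<phi> x \<and> \<phi> x \<le> 1) \<and> (\<forall>x. x \<notin> D \<longrightarrow> \<phi> x = 0) \<and>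
        (\<forall>x. ball x \<delta> \<subseteq> D \<longrightarrow> \<phi> x = 1) \<and> (\<forall>x y. \<bar>\<phi> x - \<phi> y\<bar> \<le> C * d * (norm (x - y) / \<delta>))"
    if D: "open D" "bounded D" and \<delta>: "\<delta> > 0" for D :: "'a set" and \<delta>
  proof -
    define e where "e = \<delta> / d"
    have e: "e > 0" using \<delta> d by (simp add: e_def)
    obtain r where r: "\<And>x. x \<in> D \<Longrightarrow> norm x \<le> r"
      using D(2) bounded_iff by blast
    \<comment> \<open>\<open>M\<close> is large enough that the bumps with indices in
      \<open>- int M..int M\<close> already sum to 1 on all of \<open>D\<close>.\<close>
    obtain M :: nat where M: "r * inverse e \<le> of_nat M"
      using real_arch_simple by blast
    define P where "P = PiE (Basis::'a set) (\<lambda>_. {- int M..int M})"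
    define J where "J = {j \<in> P. lattice_cell e j \<subseteq> D}"
    define \<phi> where "\<phi> = (\<lambda>x::'a. \<Sum>j\<in>J. lattice_bump e j x)"
    have fP: "finite P" unfolding P_def by (intro finite_PiE) auto
    have "finite J" using fP unfolding J_def by simp
    moreover have "J \<subseteq> P" by (auto simp: J_def)
    moreover have "P \<subseteq> extensional Basis" by (auto simp: P_def PiE_def)
    ultimately have J: "finite J" "J \<subseteq> P" "J \<subseteq> extensional Basis" by auto
    have supp: "{x. \<phi> x \<noteq> 0} \<subseteq> (\<Union>j\<in>J. lattice_cell e j)"
    proof
      fix x assume "x \<in> {x. \<phi> x \<noteq> 0}"
      then obtain j where "j \<in> J" "lattice_bump e j x \<noteq> 0"
        by (auto simp: \<phi>_def dest: sum.not_neutral_contains_not_neutral)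
      then show "x \<in> (\<Union>j\<in>J. lattice_cell e j)" using lattice_bump_nonzeroD[OF e] by blast
    qed
    have cpt: "compact (\<Union>j\<in>J. lattice_cell e j)"
      using J(1) by (intro compact_UN) (auto simp: lattice_cell_def)
    have JD: "(\<Union>j\<in>J. lattice_cell e j) \<subseteq> D"
      by (auto simp: J_def)
    have cl: "closure {x. \<phi> x \<noteq> 0} \<subseteq> (\<Union>j\<in>J. lattice_cell e j)"
      using supp cpt by (intro closure_minimal compact_imp_closed)
    have "compact (closure {x. \<phi> x \<noteq> 0})"
      using cl cpt compact_closure bounded_subset compact_imp_bounded closure_subset
          by (metis subset_trans)
    moreover have "Ck_function k \<phi>" for k
      unfolding \<phi>_def by (intro Ck_function_sum Ck_function_lattice_bump)
    ultimately have test: "\<phi> \<in> test_functions D"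
      using cl JD by (auto simp: test_functions_def)
    have nonneg: "0 \<le> \<phi> x" for x
      unfolding \<phi>_def by (intro sum_nonneg lattice_bump_nonneg)
    have le1: "\<phi> x \<le> 1" for x
    proof -
      have "\<phi> x \<le> (\<Sum>j\<in>P. lattice_bump e j x)"
        unfolding \<phi>_def using fP J(2) by (intro sum_mono2 lattice_bump_nonneg) auto
      also have "\<dots> \<le> 1"
        unfolding P_def sum_lattice_bump
      proof (rule prod_le_1)
        fix b :: 'a
        let ?t = "x \<bullet> b * inverse e"
        show "0 \<le> smooth_step (?t + of_nat M + 1) - smooth_step (?t - of_nat M) \<and>
          smooth_step (?t + of_nat M + 1) - smooth_step (?t - of_nat M) \<le> 1"
          using monoD[OF mono_smooth_step, of "?t - of_nat M" "?t + of_nat M + 1"]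
            smooth_step_bounds[of "?t - of_nat M"] smooth_step_bounds[of "?t + of_nat M + 1"]
          by simp
      qed
      finally show ?thesis .
    qed
    have eq1: "\<phi> x = 1" if x: "ball x \<delta> \<subseteq> D" for x
    proof -
      have nx: "norm x \<le> r" using x \<delta> by (intro r) (auto simp: subset_iff)
      have "\<phi> x = (\<Sum>j\<in>P. lattice_bump e j x)"
        unfolding \<phi>_def
      proof (rule sum.mono_neutral_left[OF fP J(2)], rule ballI, rule ccontr)
        fix j assume j: "j \<in> P - J" "lattice_bump e j x \<noteq> 0"
        have xj: "x \<in> lattice_cell e j" using j lattice_bump_nonzeroD[OF e] by blast
        have "lattice_cell e j \<subseteq> ball x \<delta>"
        proof
          fix y assume y: "y \<in> lattice_cell e j"
          have "\<bar>(x - y) \<bullet> b\<bar> \<le> 2 * e" if "b \<in> Basis" for b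
          proof -
            have "\<bar>x \<bullet> b * inverse e - of_int (j b)\<bar> \<le> 1" "\<bar>y \<bullet> b * inverse e - of_int (j b)\<bar> \<le> 1"
              using that xj y by (auto simp: mem_lattice_cell[OF e])
            then have "\<bar>x \<bullet> b * inverse e - y \<bullet> b * inverse e\<bar> \<le> 2" by linarith
            then have "\<bar>(x - y) \<bullet> b\<bar> * inverse e \<le> 2"
              using e by (simp add: inner_diff_left left_diff_distrib[symmetric] abs_mult)
            then show ?thesis using e by (simp add: field_simps)
          qed
          then have "norm (x - y) \<le> (\<Sum>b\<in>(Basis::'a set). 2 * e)"
            by (intro order_trans[OF norm_le_l1] sum_mono)
          also have "\<dots> < \<delta>" using \<delta> d by (simp add: e_def d_def field_simps)
          finally show "y \<in> ball x \<delta>" by (simp add: dist_norm)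
        qed
        then show False using x j by (auto simp: J_def)
      qed
      also have "\<dots> = 1"
      proof -
        have "\<bar>x \<bullet> b * inverse e\<bar> \<le> of_nat M" if "b \<in> Basis" for b
        proof -
          have "\<bar>x \<bullet> b * inverse e\<bar> \<le> r * inverse e"
            using e nx Basis_le_norm[OF that, of x] by (auto simp: abs_mult)
          then show ?thesis using M by linarith
        qed
        then have "smooth_step (x \<bullet> b * inverse e + of_nat M + 1) = 1"
           "smooth_step (x \<bullet> b * inverse e - of_nat M) = 0" if "b \<in> Basis" for b
          using that by (force intro!: smooth_step_eq_0 smooth_step_eq_1 simp: abs_le_iff)+
        then show ?thesis unfolding P_def sum_lattice_bump by simp
      qed
      finally show ?thesis .
    qed
    have "\<bar>\<phi> x - \<phi> y\<bar> \<le> C * d * (norm (x - y) / \<delta>)" for x y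
      using C(2)[OF e J(1,3), of x y] d by (simp add: \<phi>_def e_def field_simps)
    moreover have "\<phi> x = 0" if "x \<notin> D" for x
      using supp JD that by blast
    ultimately show ?thesis using test nonneg le1 eq1 by blast
  qed
  then show ?thesis using C(1) d by (intro exI[of _ "C * d"]) auto
qed

subsection \<open>The capped kernel\<close>

lemma ex_dyadic_scale:
  fixes t :: real
  assumes "1 \<le> t"
  shows "\<exists>k::nat. 2 ^ k \<le> t \<and> t \<le> 2 ^ Suc k"
proof -
  define k where "k = nat \<lfloor>log 2 t\<rfloor>"
  have "real k \<le> log 2 t" "log 2 t \<le> real (Suc k)"
    using assms by (auto simp: k_def zero_le_log_cancel_iff) linarith+
  then have "2 powr real k \<le> t" "t \<le> 2 powr real (Suc k)"
    using assms by (auto simp: le_log_iff log_le_iff)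
  then show ?thesis by (auto simp: powr_realpow[symmetric] simp del: of_nat_Suc power_Suc)
qed

text \<open>Every nonzero point lies in a dyadic shell about radius \<open>r\<close>. On the outer
  shells the cap 1 is used; on the inner ones the quadratic factor contributes
  \<open>(1 / 2) ^ (2 * k)\<close>. Bounding each shell by a ball leaves only volumes of balls to
  integrate.\<close>

lemma kernel_dyadic_bound:
  fixes z :: "'a::euclidean_space"
  assumes r: "r > 0" and p: "p > 0"
  shows "ennreal (min 1 ((norm z / r)\<^sup>2) / norm z powr p) \<le>
    (\<Sum>k. ennreal ((2 ^ k * r) powr (- p)) * indicator (cball 0 (2 ^ Suc k * r)) z) +
    (\<Sum>k. ennreal ((1 / 2) ^ (2 * k) * ((1 / 2) ^ Suc k * r) powr (- p)) * indicator (cball 0 ((1 /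
        2) ^ k * r)) z)"
  (is "_ \<le> (\<Sum>k. ?f k) + (\<Sum>k. ?g k)")
proof -
  consider "z = 0" | "r \<le> norm z" | "z \<noteq> 0" "norm z < r" by force
  then show ?thesis
  proof cases
    case 2
    then obtain k where k: "2 ^ k \<le> norm z / r" "norm z / r \<le> 2 ^ Suc k"
      using ex_dyadic_scale[of "norm z / r"] r by (auto simp: field_simps)
    have k': "2 ^ k * r \<le> norm z" "norm z \<le> 2 ^ Suc k * r"
      using k r by (simp_all add: field_simps)
    have "min 1 ((norm z / r)\<^sup>2) / norm z powr p \<le> 1 / norm z powr p"
      by (intro divide_right_mono) auto
    also have "\<dots> = norm z powr (- p)" by (simp add: powr_minus_divide)
    also have "\<dots> \<le> (2 ^ k * r) powr (- p)"
      using k' r p by (intro powr_mono2') auto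
    finally have "ennreal (min 1 ((norm z / r)\<^sup>2) / norm z powr p) \<le> ?f k"
      using k' by (simp add: ennreal_leI)
    also have "\<dots> \<le> (\<Sum>k. ?f k)"
      using sum_le_suminf[of ?f "{k}"] by (simp del: sum_mult_indicator indicator_simps power_Suc)
    finally show ?thesis by (rule order_trans) simp
  next
    case 3
    then have "1 \<le> r / norm z" by (simp add: field_simps)
    then obtain k where k: "2 ^ k \<le> r / norm z" "r / norm z \<le> 2 ^ Suc k"
      using ex_dyadic_scale by blast
    have k': "(1 / 2) ^ Suc k * r \<le> norm z" "norm z \<le> (1 / 2) ^ k * r"
      using k r 3 by (simp_all add: field_simps power_one_over)
    have "min 1 ((norm z / r)\<^sup>2) / norm z powr p \<le> (norm z / r)\<^sup>2 / norm z powr p"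
      by (intro divide_right_mono) auto
    also have "\<dots> = (norm z / r)\<^sup>2 * norm z powr (- p)" by (simp add: powr_minus_divide)
    also have "\<dots> \<le> ((1 / 2) ^ k)\<^sup>2 * ((1 / 2) ^ Suc k * r) powr (- p)"
      using k' r p by (intro mult_mono power_mono powr_mono2') (auto simp: divide_le_eq)
    also have "((1 / 2) ^ k)\<^sup>2 = (1 / 2 :: real) ^ (2 * k)"
        by (simp add: power_mult[symmetric] mult.commute)
    finally have "ennreal (min 1 ((norm z / r)\<^sup>2) / norm z powr p) \<le> ?g k"
      using k' by (simp add: ennreal_leI)
    also have "\<dots> \<le> (\<Sum>k. ?g k)"
      using sum_le_suminf[of ?g "{k}"] by (simp del: sum_mult_indicator indicator_simps power_Suc)
    finally show ?thesis by (rule order_trans) simp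
  qed simp
qed

lemma suminf_ennreal_geometric:
  assumes "0 \<le> c" "0 \<le> q" "q < 1"
  shows "(\<Sum>k. ennreal (c * q ^ k)) = ennreal (c / (1 - q))"
proof -
  have "(\<lambda>k. c * q ^ k) sums (c * (1 / (1 - q)))"
    using assms by (intro sums_mult geometric_sums) auto
  then show ?thesis
    using assms by (intro suminf_ennreal_eq) auto
qed

text \<open>Both dyadic sums become geometric after integration: the outer ratio \<open>q1\<close>
  is below 1 because s > 0, the inner ratio \<open>q2\<close> because s < 1. They give the two
  summands of \<open>K\<close>, and the power of \<open>r\<close> is what remains of
  \<open>r powr (- p) * r ^ n\<close>.\<close>

lemma kernel_integral_bound:
  assumes "0 < s" "s < 1"
  shows "\<exists>K\<ge>0. \<forall>r>0. (\<integral>\<^sup>+z. ennreal (min 1 ((norm z / r)\<^sup>2) / norm (z::'a::euclidean_space) powr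
      (real DIM('a) + 2 * s)) \<partial>lborel)
    \<le> ennreal (K * r powr (- 2 * s))"
proof -
  define n where "n = DIM('a)"
  define p where "p = real n + 2 * s"
  define \<omega> where "\<omega> = unit_ball_vol (real n)"
  have \<omega>: "\<omega> \<ge> 0" by (simp add: \<omega>_def)
  have p: "p > 0" using assms by (simp add: p_def add_nonneg_pos)
  define q1 where "q1 = (2::real) powr (- 2 * s)"
  define q2 where "q2 = (2::real) powr (2 * s - 2)"
  have q: "0 \<le> q1" "q1 < 1" "0 \<le> q2" "q2 < 1"
    using assms powr_less_mono[of "- 2 * s" 0 2] powr_less_mono[of "2 * s - 2" 0 2]
    by (simp_all add: q1_def q2_def)
  define K where "K = \<omega> * 2 ^ n / (1 - q1) + \<omega> * 2 powr p / (1 - q2)"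
  have K: "K \<ge> 0" using q \<omega> by (simp add: K_def)
  have "(\<integral>\<^sup>+z. ennreal (min 1 ((norm z / r)\<^sup>2) / norm (z::'a) powr p) \<partial>lborel)
      \<le> ennreal (K * r powr (- 2 * s))"
    if r: "r > 0" for r
  proof -
    have rp: "r powr (- p) * r ^ n = r powr (- 2 * s)"
      using r by (simp add: p_def powr_realpow[symmetric] powr_add[symmetric])
    have 1: "(2 ^ k * r) powr (- p) * (\<omega> * (2 ^ Suc k * r) ^ n)
        = \<omega> * 2 ^ n * r powr (- 2 * s) * q1 ^ k" for k
    proof -
      have a: "(2 ^ k * r) powr (- p) = 2 powr (- p * k) * r powr (- p)"
        using r by (simp add: powr_mult powr_realpow[symmetric] powr_powr mult.commute)
      have b: "(2 ^ Suc k * r) ^ n = 2 ^ n * 2 powr (real n * k) * r ^ n"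
        by (simp add: power_mult_distrib powr_realpow[symmetric] powr_powr mult.commute
            power_mult[symmetric])
      have c: "(2::real) powr (- p * k) * 2 powr (real n * k) = q1 ^ k"
        by (simp add: q1_def p_def powr_add[symmetric] powr_realpow[symmetric] powr_powr
            algebra_simps)
      show ?thesis unfolding a b c[symmetric] rp[symmetric] by (simp add: mult_ac)
    qed
    have 2: "(1 / 2) ^ (2 * k) * ((1 / 2) ^ Suc k * r) powr (- p) * (\<omega> * ((1 / 2) ^ k * r) ^ n) =
        \<omega> * 2 powr p * r powr (- 2 * s) * q2 ^ k" for k
    proof -
      have half: "(1 / 2 :: real) ^ j = 2 powr (- real j)" for j
        by (simp add: powr_minus powr_realpow power_one_over inverse_eq_divide)
      have a: "((1 / 2) ^ Suc k * r) powr (- p) = 2 powr p * 2 powr (p * k) * r powr (- p)"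
        using r unfolding half by (simp add: powr_mult powr_powr powr_add[symmetric] algebra_simps)
      have b: "((1 / 2) ^ k * r) ^ n = 2 powr (- (real n * k)) * r ^ n"
        by (simp add: power_mult_distrib half powr_power mult.commute)
      have c: "(1 / 2 :: real) ^ (2 * k) = 2 powr (- 2 * k)"
        by (simp add: half)
      have d: "(2::real) powr (- 2 * k) * 2 powr (p * k) * 2 powr (- (real n * k)) = q2 ^ k"
        by (simp add: q2_def p_def powr_add[symmetric] powr_realpow[symmetric] powr_powr
            algebra_simps)
      show ?thesis unfolding a b c d[symmetric] rp[symmetric] by (simp add: mult_ac)
    qed
    let ?f = "\<lambda>k (z::'a). ennreal ((2 ^ k * r) powr (- p)) * indicator (cball 0 (2 ^ Suc k * r)) z"
    let ?g = "\<lambda>k (z::'a). ennreal ((1 / 2) ^ (2 * k) * ((1 / 2) ^ Suc k * r) powr (- p)) * indicator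
        (cball 0 ((1 / 2) ^ k * r)) z"
    have m1: "?f k \<in> borel_measurable lborel" for k
      by (intro borel_measurable_times_ennreal borel_measurable_const borel_measurable_indicator)
          auto
    have m2: "?g k \<in> borel_measurable lborel" for k
      by (intro borel_measurable_times_ennreal borel_measurable_const borel_measurable_indicator)
          auto
    have "(\<integral>\<^sup>+z. ennreal (min 1 ((norm z / r)\<^sup>2) / norm (z::'a) powr p) \<partial>lborel)
        \<le> (\<integral>\<^sup>+z. (\<Sum>k. ?f k z) + (\<Sum>k. ?g k z) \<partial>lborel)"
      by (intro nn_integral_mono kernel_dyadic_bound r p)
    also have "\<dots> = (\<integral>\<^sup>+z. (\<Sum>k. ?f k z) \<partial>lborel) + (\<integral>\<^sup>+z. (\<Sum>k. ?g k z) \<partial>lborel)"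
      by (intro nn_integral_add borel_measurable_suminf_order m1 m2)
    also have "(\<integral>\<^sup>+z. (\<Sum>k. ?f k z) \<partial>lborel) = (\<Sum>k. \<integral>\<^sup>+z. ?f k z \<partial>lborel)"
      by (rule nn_integral_suminf[OF m1])
    also have "(\<integral>\<^sup>+z. (\<Sum>k. ?g k z) \<partial>lborel) = (\<Sum>k. \<integral>\<^sup>+z. ?g k z \<partial>lborel)"
      by (rule nn_integral_suminf[OF m2])
    also have "(\<lambda>k. \<integral>\<^sup>+z. ?f k z \<partial>lborel) = (\<lambda>k. ennreal (\<omega> * 2 ^ n * r powr (- 2 * s) * q1 ^ k))"
    proof
      fix k
      have "(\<integral>\<^sup>+z. ?f k z \<partial>lborel) = ennreal ((2 ^ k * r) powr (- p)) * emeasure lborel (cball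
          (0::'a) (2 ^ Suc k * r))"
        by (rule nn_integral_cmult_indicator) simp
      also have "\<dots> = ennreal ((2 ^ k * r) powr (- p)) * ennreal (\<omega> * (2 ^ Suc k * r) ^ n)"
        using r by (subst emeasure_cball) (simp_all add: \<omega>_def n_def)
      also have "\<dots> = ennreal (\<omega> * 2 ^ n * r powr (- 2 * s) * q1 ^ k)"
        unfolding 1[symmetric] by (rule ennreal_mult'[symmetric]) simp
      finally show "(\<integral>\<^sup>+z. ?f k z \<partial>lborel) = ennreal (\<omega> * 2 ^ n * r powr (- 2 * s) * q1 ^ k)" .
    qed
    also have "(\<lambda>k. \<integral>\<^sup>+z. ?g k z \<partial>lborel)
        = (\<lambda>k. ennreal (\<omega> * 2 powr p * r powr (- 2 * s) * q2 ^ k))"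
    proof
      fix k
      have "(\<integral>\<^sup>+z. ?g k z \<partial>lborel) = ennreal ((1 / 2) ^ (2 * k) * ((1 / 2) ^ Suc k * r) powr (- p))
          * emeasure lborel (cball (0::'a) ((1 / 2) ^ k * r))"
        by (rule nn_integral_cmult_indicator) simp
      also have "\<dots> = ennreal ((1 / 2) ^ (2 * k) * ((1 / 2) ^ Suc k * r) powr (- p)) * ennreal (\<omega> *
          ((1 / 2) ^ k * r) ^ n)"
        using r by (subst emeasure_cball) (simp_all add: \<omega>_def n_def)
      also have "\<dots> = ennreal (\<omega> * 2 powr p * r powr (- 2 * s) * q2 ^ k)"
        unfolding 2[symmetric] by (rule ennreal_mult'[symmetric]) simp
      finally show "(\<integral>\<^sup>+z. ?g k z \<partial>lborel) = ennreal (\<omega> * 2 powr p * r powr (- 2 * s) * q2 ^ k)" .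
    qed
    also have "(\<Sum>k. ennreal (\<omega> * 2 ^ n * r powr (- 2 * s) * q1 ^ k))
        + (\<Sum>k. ennreal (\<omega> * 2 powr p * r powr (- 2 * s) * q2 ^ k))
       = ennreal (K * r powr (- 2 * s))"
    proof -
      have "(\<Sum>k. ennreal (\<omega> * 2 ^ n * r powr (- 2 * s) * q1 ^ k))
          = ennreal (\<omega> * 2 ^ n * r powr (- 2 * s) / (1 - q1))"
        by (rule suminf_ennreal_geometric) (use q \<omega> in auto)
      moreover have "(\<Sum>k. ennreal (\<omega> * 2 powr p * r powr (- 2 * s) * q2 ^ k))
          = ennreal (\<omega> * 2 powr p * r powr (- 2 * s) / (1 - q2))"
        by (rule suminf_ennreal_geometric) (use q \<omega> in auto)
      ultimately show ?thesis
        using q \<omega> by (simp add: ennreal_plus[symmetric] K_def distrib_right del: ennreal_plus)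
    qed
    finally show ?thesis .
  qed
  then show ?thesis using K unfolding p_def n_def by blast
qed

subsection \<open>Tubular neighbourhoods of the frontier\<close>

definition tube :: "'a::metric_space set \<Rightarrow> real \<Rightarrow> 'a set" where
  "tube F \<delta> = (\<Union>p\<in>F. ball p \<delta>)"

lemma open_tube [intro, simp]: "open (tube F \<delta>)"
  by (auto simp: tube_def)

lemma tube_mono: "F \<subseteq> G \<Longrightarrow> tube F \<delta> \<subseteq> tube G \<delta>"
  by (auto simp: tube_def)

text \<open>The upper Minkowski content of codimension one is finite.\<close>

definition thin :: "'a::euclidean_space set \<Rightarrow> bool" where
  "thin F \<longleftrightarrow> (\<exists>C\<ge>0. \<forall>\<delta>\<in>{0<..1}. emeasure lborel (tube F \<delta>) \<le> ennreal (C * \<delta>))"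

lemma thin_subset: "thin G \<Longrightarrow> F \<subseteq> G \<Longrightarrow> thin F"
  unfolding thin_def
proof (elim exE conjE)
  fix C assume C: "0 \<le> C" "\<forall>\<delta>\<in>{0<..1}. emeasure lborel (tube G \<delta>) \<le> ennreal (C * \<delta>)" and "F \<subseteq> G"
  have "emeasure lborel (tube F \<delta>) \<le> emeasure lborel (tube G \<delta>)" for \<delta>
    using tube_mono[OF \<open>F \<subseteq> G\<close>] by (intro emeasure_mono) auto
  then show "\<exists>C\<ge>0. \<forall>\<delta>\<in>{0<..1}. emeasure lborel (tube F \<delta>) \<le> ennreal (C * \<delta>)"
    using C order_trans by blast
qed

lemma thin_Un:
  assumes "thin F" "thin G"
  shows "thin (F \<union> G)"
proof -
  obtain A B where A: "A \<ge> 0" "\<And>\<delta>. \<delta> \<in> {0<..1} \<Longrightarrow> emeasure lborel (tube F \<delta>) \<le> ennreal (A * \<delta>)"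
    and B: "B \<ge> 0" "\<And>\<delta>. \<delta> \<in> {0<..1} \<Longrightarrow> emeasure lborel (tube G \<delta>) \<le> ennreal (B * \<delta>)"
    using assms unfolding thin_def by metis
  have "emeasure lborel (tube (F \<union> G) \<delta>) \<le> ennreal ((A + B) * \<delta>)" if "\<delta> \<in> {0<..1}" for \<delta>
  proof -
    have "tube (F \<union> G) \<delta> = tube F \<delta> \<union> tube G \<delta>" by (auto simp: tube_def)
    then have "emeasure lborel (tube (F \<union> G) \<delta>) \<le> emeasure lborel (tube F \<delta>)
        + emeasure lborel (tube G \<delta>)"
      by (simp add: emeasure_subadditive borel_open)
    also have "\<dots> \<le> ennreal (A * \<delta>) + ennreal (B * \<delta>)"
      by (intro add_mono A B that)
    also have "\<dots> = ennreal ((A + B) * \<delta>)"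
      using A(1) B(1) that by (simp add: ennreal_plus[symmetric] distrib_right del: ennreal_plus)
    finally show ?thesis .
  qed
  then show ?thesis unfolding thin_def using A(1) B(1) by (intro exI[of _ "A + B"]) auto
qed

lemma thin_empty: "thin {}"
  unfolding thin_def by (intro exI[of _ 0]) (auto simp: tube_def)

lemma thin_UN: "finite I \<Longrightarrow> (\<And>i. i \<in> I \<Longrightarrow> thin (F i)) \<Longrightarrow> thin (\<Union>i\<in>I. F i)"
  by (induction I rule: finite_induct) (auto intro: thin_Un thin_empty)

text \<open>Volume packing: the balls of radius \<open>\<rho> / 2\<close> about the points are
  disjoint, and they stay inside \<open>ball c (r + 1)\<close> because
  \<open>\<rho> \<le> 2\<close>.\<close>

lemma card_separated_le:
  fixes Q :: "'b::euclidean_space set"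
  assumes fin: "finite Q" and r: "Q \<subseteq> ball c r" "0 \<le> r" and \<rho>: "0 < \<rho>" "\<rho> \<le> 2"
    and sep: "\<And>x y. x \<in> Q \<Longrightarrow> y \<in> Q \<Longrightarrow> x \<noteq> y \<Longrightarrow> \<rho> \<le> dist x y"
  shows "real (card Q) \<le> (2 * (r + 1) / \<rho>) ^ DIM('b)"
proof -
  let ?m = "DIM('b)"
  let ?w = "unit_ball_vol (real ?m)"
  have w: "?w > 0" by simp
  have disj: "disjoint_family_on (\<lambda>q. ball q (\<rho> / 2)) Q"
    unfolding disjoint_family_on_def
  proof safe
    fix x y z assume "x \<in> Q" "y \<in> Q" "x \<noteq> y" "z \<in> ball x (\<rho> / 2)" "z \<in> ball y (\<rho> / 2)"
    then show "z \<in> {}"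
      using sep[of x y] dist_triangle2[of x y z] by (auto simp: dist_commute)
  qed
  have "ennreal (real (card Q) * (?w * (\<rho> / 2) ^ ?m)) = (\<Sum>q\<in>Q. emeasure lborel (ball q (\<rho> / 2)))"
    using \<rho> by (simp add: emeasure_ball ennreal_mult ennreal_of_nat_eq_real_of_nat)
  also have "\<dots> = emeasure lborel (\<Union>q\<in>Q. ball q (\<rho> / 2))"
    using fin disj by (intro sum_emeasure) auto
  also have "\<dots> \<le> emeasure lborel (ball c (r + 1))"
  proof (rule emeasure_mono)
    show "(\<Union>q\<in>Q. ball q (\<rho> / 2)) \<subseteq> ball c (r + 1)"
    proof
      fix z assume "z \<in> (\<Union>q\<in>Q. ball q (\<rho> / 2))"
      then obtain q where "q \<in> Q" "dist q z < \<rho> / 2" by auto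
      then show "z \<in> ball c (r + 1)"
        using r(1) \<rho> dist_triangle[of c z q] by (force simp: subset_iff)
    qed
  qed simp
  also have "\<dots> = ennreal (?w * (r + 1) ^ ?m)"
    using r by (simp add: emeasure_ball)
  finally have "real (card Q) * (?w * (\<rho> / 2) ^ ?m) \<le> ?w * (r + 1) ^ ?m"
    using w r by (subst (asm) ennreal_le_iff) auto
  then have "real (card Q) * (\<rho> / 2) ^ ?m \<le> (r + 1) ^ ?m"
    using w by (simp add: mult.left_commute[of _ ?w])
  then have "real (card Q) \<le> (r + 1) ^ ?m / (\<rho> / 2) ^ ?m"
    using \<rho> by (simp add: pos_le_divide_eq)
  also have "\<dots> = (2 * (r + 1) / \<rho>) ^ ?m"
    by (simp add: power_divide[symmetric] mult.commute[of _ 2])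
  finally show ?thesis .
qed

text \<open>Counting separated points of the base avoids any appeal to the invariance of Lebesgue measure
  under rotations.\<close>

lemma thin_lipschitz_graph:
  fixes G :: "(real \<times> 'b::euclidean_space) set"
  assumes A: "orthogonal_transformation A" and g: "L-lipschitz_on UNIV (g :: 'b \<Rightarrow> real)"
    and G: "G \<subseteq> ball p r" and graph: "\<And>x. x \<in> G \<Longrightarrow> fst (A x + b) = g (snd (A x + b))"
  shows "thin G"
proof (cases "G = {}")
  case False
  then have r: "r > 0" using G by (metis ball_eq_empty linorder_not_le subset_empty)
  define T where "T = (\<lambda>x. A x + b)"
  have L: "L \<ge> 0" using g lipschitz_on_nonneg by blast
  have iso: "dist (T x) (T y) = dist x y" for x y
  proof -
    have "T x - T y = A (x - y)"
      using A by (simp add: T_def orthogonal_transformation_def linear_diff)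
    then show ?thesis
      using A by (simp add: dist_norm orthogonal_transformation_norm)
  qed
  \<comment> \<open>On the graph, distances are controlled by distances of base points. A
    \<delta>-separated subset of \<open>G\<close> thus projects injectively to a
    \<open>\<delta> / (L + 1)\<close>-separated subset of the base, whose dimension is one
    less.\<close>
  have base: "dist x y \<le> (L + 1) * dist (snd (T x)) (snd (T y))" if "x \<in> G" "y \<in> G" for x y
  proof -
    have "dist x y = sqrt ((dist (fst (T x)) (fst (T y)))\<^sup>2 + (dist (snd (T x)) (snd (T y)))\<^sup>2)"
      unfolding iso[of x y, symmetric] by (simp add: dist_prod_def)
    also have "\<dots> \<le> dist (fst (T x)) (fst (T y)) + dist (snd (T x)) (snd (T y))"
      by (rule sqrt_sum_squares_le_sum) auto
    also have "dist (fst (T x)) (fst (T y)) \<le> L * dist (snd (T x)) (snd (T y))"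
      using graph[OF that(1)] graph[OF that(2)] lipschitz_onD[OF g, of "snd (T x)" "snd (T y)"]
      by (simp add: T_def)
    finally show ?thesis by (simp add: algebra_simps)
  qed
  define m where "m = DIM('b)"
  define \<omega> where "\<omega> = unit_ball_vol (real (Suc m))"
  have \<omega>: "\<omega> > 0" by (simp add: \<omega>_def)
  define K where "K = 2 * (r + 1) * (L + 1)"
  have K: "K > 0" using r L by (simp add: K_def)
  have "emeasure lborel (tube G \<delta>) \<le> ennreal (K ^ m * \<omega> * 2 ^ Suc m * \<delta>)" if \<delta>: "0 < \<delta>" "\<delta> \<le> 1"
      for \<delta>
  proof -
    define S where "S = {P. finite P \<and> P \<subseteq> G \<and> (\<forall>x\<in>P. \<forall>y\<in>P. x \<noteq> y \<longrightarrow> \<delta> \<le> dist x y)}"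
    have card_le: "real (card P) \<le> (K / \<delta>) ^ m" if P: "P \<in> S" for P
    proof -
      let ?f = "\<lambda>x. snd (T x)"
      have sep: "\<delta> / (L + 1) \<le> dist (?f x) (?f y)" if "x \<in> P" "y \<in> P" "x \<noteq> y" for x y
      proof -
        have "\<delta> \<le> dist x y" using P that by (auto simp: S_def)
        also have "\<dots> \<le> (L + 1) * dist (?f x) (?f y)" using P that by (intro base) (auto simp: S_def)
        finally show ?thesis using L by (simp add: field_simps)
      qed
      have inj: "inj_on ?f P"
      proof (rule inj_onI, rule ccontr)
        fix x y assume "x \<in> P" "y \<in> P" "?f x = ?f y" "x \<noteq> y"
        then show False using sep[of x y] \<delta> L by (simp add: field_simps)
      qed
      have "real (card (?f ` P)) \<le> (2 * (r + 1) / (\<delta> / (L + 1))) ^ DIM('b)"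
      proof (rule card_separated_le)
        show "finite (?f ` P)" using P by (simp add: S_def)
        show "?f ` P \<subseteq> ball (?f p) r"
        proof clarify
          fix x assume "x \<in> P"
          then have "dist p x < r" using P G by (auto simp: S_def)
          then show "?f x \<in> ball (?f p) r"
            using dist_snd_le[of "T p" "T x"] iso[of p x] by simp
        qed
        have "\<delta> / (L + 1) \<le> \<delta>" using \<delta> L by (simp add: field_simps)
        then show "\<delta> / (L + 1) \<le> 2" using \<delta> by simp
        show "\<delta> / (L + 1) \<le> dist x y" if "x \<in> ?f ` P" "y \<in> ?f ` P" "x \<noteq> y" for x y
          using that sep by blast
      qed (use \<delta> L r in auto)
      then show ?thesis
        using card_image[OF inj] by (simp add: K_def m_def)
    qed
    \<comment> \<open>The uniform bound on cardinalities yields a separated set \<open>P\<close> of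
      largest size. By maximality the \<delta>-balls about \<open>P\<close> cover \<open>G\<close>,
      so the balls of radius \<open>2 * \<delta>\<close> cover the tube.\<close>
    define N where "N = nat \<lfloor>(K / \<delta>) ^ m\<rfloor>"
    have "card P \<le> N" if "P \<in> S" for P
      using card_le[OF that] by (simp add: N_def le_nat_floor)
    moreover have "{} \<in> S" by (simp add: S_def)
    ultimately obtain P where P: "P \<in> S" "\<And>Q. Q \<in> S \<Longrightarrow> card Q \<le> card P"
      using ex_has_greatest_nat[of "\<lambda>P. P \<in> S" "{}" card "Suc N"] by (metis less_Suc_eq_le)
    have cover: "\<exists>q\<in>P. dist q x < \<delta>" if x: "x \<in> G" for x
    proof (rule ccontr)
      assume "\<not> (\<exists>q\<in>P. dist q x < \<delta>)"
      then have far: "\<And>q. q \<in> P \<Longrightarrow> \<delta> \<le> dist q x" by force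
      then have "x \<notin> P" using \<delta> by fastforce
      moreover have "insert x P \<in> S"
        using P(1) x far by (auto simp: S_def dist_commute)
      moreover have "finite P" using P(1) by (simp add: S_def)
      ultimately show False using P(2)[of "insert x P"] by simp
    qed
    have "tube G \<delta> \<subseteq> (\<Union>q\<in>P. ball q (2 * \<delta>))"
    proof
      fix z assume "z \<in> tube G \<delta>"
      then obtain x where x: "x \<in> G" "dist x z < \<delta>" by (auto simp: tube_def)
      obtain q where "q \<in> P" "dist q x < \<delta>" using cover x(1) by blast
      then show "z \<in> (\<Union>q\<in>P. ball q (2 * \<delta>))"
        using x(2) dist_triangle[of q z x] by force
    qed
    then have "emeasure lborel (tube G \<delta>) \<le> emeasure lborel (\<Union>q\<in>P. ball q (2 * \<delta>))"
      by (intro emeasure_mono) (simp_all add: borel_open open_UN)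
    also have "\<dots> \<le> (\<Sum>q\<in>P. emeasure lborel (ball q (2 * \<delta>)))"
      using P(1) by (intro emeasure_subadditive_finite) (simp_all add: S_def image_subset_iff)
    also have "\<dots> = (\<Sum>q\<in>P. ennreal (\<omega> * (2 * \<delta>) ^ Suc m))"
    proof (rule sum.cong[OF refl])
      fix q :: "real \<times> 'b"
      show "emeasure lborel (ball q (2 * \<delta>)) = ennreal (\<omega> * (2 * \<delta>) ^ Suc m)"
        using emeasure_ball[of "2 * \<delta>" q] \<delta> by (simp add: \<omega>_def m_def)
    qed
    also have "\<dots> = ennreal (real (card P) * (\<omega> * (2 * \<delta>) ^ Suc m))"
      using \<delta> \<omega> by (subst ennreal_mult) (simp_all add: ennreal_of_nat_eq_real_of_nat)
    also have "\<dots> \<le> ennreal ((K / \<delta>) ^ m * (\<omega> * (2 * \<delta>) ^ Suc m))"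
      using card_le[OF P(1)] \<delta> \<omega> by (intro ennreal_leI mult_right_mono) auto
    \<comment> \<open>A number of balls of order \<delta> to the power -m, each of volume of order
      \<delta> to the power m + 1, leaves exactly one factor \<delta>.\<close>
    also have "(K / \<delta>) ^ m * (\<omega> * (2 * \<delta>) ^ Suc m) = K ^ m * \<omega> * 2 ^ Suc m * \<delta>"
      using \<delta> by (simp add: power_mult_distrib power_divide)
    finally show ?thesis .
  qed
  then show ?thesis
    unfolding thin_def using K \<omega> by (intro exI[of _ "K ^ m * \<omega> * 2 ^ Suc m"]) auto
qed (simp add: thin_empty)

text \<open>A piece of the hyperplane is the graph of a constant function, with the identity as
  rigid motion. This handles the two flat cuts.\<close>

lemma thin_hyperplane:
  fixes G :: "(real \<times> 'b::euclidean_space) set"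
  assumes "bounded G" "\<And>x. x \<in> G \<Longrightarrow> fst x = t"
  shows "thin G"
proof -
  obtain r where "G \<subseteq> ball 0 r"
    using assms(1) bounded_subset_ballD by blast
  moreover have "0-lipschitz_on UNIV (\<lambda>_::'b. t)" by (simp add: lipschitz_on_def)
  moreover have "orthogonal_transformation (\<lambda>x::real \<times> 'b. x)"
      by (simp add: orthogonal_transformation_def linear_id[unfolded id_def])
  ultimately show ?thesis
    using assms(2) by (intro thin_lipschitz_graph[of "\<lambda>x. x" 0 "\<lambda>_. t" G 0 r 0]) auto
qed

text \<open>Compactness reduces \<open>F\<close> to finitely many graph patches. The whole frontier
  may be unbounded, so only compact pieces are claimed to be thin.\<close>

lemma thin_frontier_lipschitz:
  fixes \<Omega> :: "(real \<times> 'b::euclidean_space) set"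
  assumes "lipschitz_set \<Omega>" and F: "compact F" "F \<subseteq> frontier \<Omega>"
  shows "thin F"
proof -
  have "\<exists>r>0. thin (frontier \<Omega> \<inter> ball p r)" if "p \<in> F" for p
  proof -
    have p: "p \<in> frontier \<Omega>" using F(2) that by blast
    obtain r A b g L where "r > 0" "orthogonal_transformation A" "L-lipschitz_on UNIV (g :: 'b \<Rightarrow>
        real)"
      and *: "frontier \<Omega> \<inter> ball p r = {x \<in> ball p r. fst (A x + b) = g (snd (A x + b))}"
      using bspec[OF conjunct2[OF assms(1)[unfolded lipschitz_set_def]] p] by (elim exE conjE)
    moreover have "thin (frontier \<Omega> \<inter> ball p r)"
      by (rule thin_lipschitz_graph[OF calculation(2,3), of _ p r b]) (use * in auto)
    ultimately show ?thesis by blast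
  qed
  then obtain r where r: "\<And>p. p \<in> F \<Longrightarrow> r p > 0 \<and> thin (frontier \<Omega> \<inter> ball p (r p))"
    by metis
  have "F \<subseteq> (\<Union>p\<in>F. ball p (r p))" using r by force
  then obtain I where I: "I \<subseteq> F" "finite I" "F \<subseteq> (\<Union>p\<in>I. ball p (r p))"
    using compactE_image[OF F(1), of F "\<lambda>p. ball p (r p)"] by auto
  have "thin (\<Union>p\<in>I. frontier \<Omega> \<inter> ball p (r p))"
    using I r by (intro thin_UN) auto
  then show ?thesis
    by (rule thin_subset) (use I(3) F(2) in blast)
qed

text \<open>The frontier of the intersection splits into a compact piece of
  \<open>frontier \<Omega>\<close> and pieces of the two hyperplanes. How these pieces meet does not
  matter, since thinness is stable under unions.\<close>

lemma thin_frontier_slab: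
  fixes \<Omega> :: "(real \<times> 'b::euclidean_space) set"
  assumes "lipschitz_set \<Omega>" and bdd: "bounded (\<Omega> \<inter> {x. a < fst x \<and> fst x < b})"
  shows "thin (frontier (\<Omega> \<inter> {x. a < fst x \<and> fst x < b}))"
proof -
  let ?T = "{x :: real \<times> 'b. a < fst x \<and> fst x < b}" and ?D = "\<Omega> \<inter> {x. a < fst x \<and> fst x < b}"
  have "?T = {a<..<b} \<times> UNIV" by auto
  then have "frontier ?T \<subseteq> {x. fst x = a} \<union> {x. fst x = b}"
    using closure_minimal[of "{a<..<b}" "{a..b}"]
    by (force simp: frontier_def closure_Times interior_Times)
  then have "frontier ?D \<subseteq> (closure ?D \<inter> frontier \<Omega>) \<union> ((closure ?D \<inter> {x. fst x
      = a}) \<union> (closure ?D \<inter> {x. fst x = b}))"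
    by (auto simp: frontier_Int)
  moreover have 1: "thin (closure ?D \<inter> frontier \<Omega>)"
    using bdd by (intro thin_frontier_lipschitz[OF assms(1)] compact_Int_closed) (auto
        simp: compact_closure)
  moreover have 2: "thin (closure ?D \<inter> {x. fst x = c})" for c
    using bdd by (intro thin_hyperplane[of _ c]) (auto intro: bounded_subset[OF bounded_closure])
  ultimately show ?thesis
    using thin_subset[OF thin_Un[OF 1 thin_Un[OF 2 2]]] by simp
qed

subsection \<open>Slices and decay\<close>

text \<open>Cross-sections are measured by Lebesgue measure on the second factor, so that Fubini
  applies directly; \<open>slice_le_hausdorff_measure\<close> makes the link to the decay
  condition.\<close>

definition slice :: "(real \<times> 'b::euclidean_space) set \<Rightarrow> real \<Rightarrow> ennreal" where
  "slice S t = emeasure lborel {y. (t, y) \<in> S}"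

lemma nn_integral_fst_slice:
  fixes S :: "(real \<times> 'b::euclidean_space) set" and F :: "real \<Rightarrow> ennreal"
  assumes S: "open S"
  shows "F \<in> borel_measurable borel \<Longrightarrow>
      (\<integral>\<^sup>+x. F (fst x) * indicator S x \<partial>lborel) = (\<integral>\<^sup>+t. F t * slice S t \<partial>lborel)"
    and "slice S \<in> borel_measurable borel"
proof -
  have S'[measurable]: "S \<in> sets (lborel \<Otimes>\<^sub>M lborel)"
    unfolding lborel_prod using S by simp
  have sl: "slice S t = (\<integral>\<^sup>+y. indicator S (t, y) \<partial>lborel)" for t
  proof -
    have "open ((\<lambda>y. (t, y)) -` S)"
      using S by (intro open_vimage) (auto intro!: continuous_intros)
    then have "(\<integral>\<^sup>+y. indicator ((\<lambda>y. (t, y)) -` S) y \<partial>lborel) = slice S t"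
      by (subst nn_integral_indicator) (auto simp: slice_def vimage_def)
    then show ?thesis by (simp add: indicator_def)
  qed
  show "slice S \<in> borel_measurable borel"
    unfolding sl[abs_def] by measurable
  assume F[measurable]: "F \<in> borel_measurable borel"
  have "(\<integral>\<^sup>+x. F (fst x) * indicator S x \<partial>lborel) =
      (\<integral>\<^sup>+t. (\<integral>\<^sup>+y. F (fst (t, y)) * indicator S (t, y) \<partial>lborel) \<partial>(lborel :: real measure))"
    unfolding lborel_prod[symmetric] by (subst lborel.nn_integral_fst) auto
  also have "\<dots> = (\<integral>\<^sup>+t. F t * slice S t \<partial>lborel)"
    by (intro nn_integral_cong) (simp add: nn_integral_cmult sl)
  finally show "(\<integral>\<^sup>+x. F (fst x) * indicator S x \<partial>lborel) = (\<integral>\<^sup>+t. F t * slice S t \<partial>lborel)" .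
qed

text \<open>Each covering set projects into a ball whose radius is its full diameter, centred at the
  projection of one of its points. Using the diameter rather than half of it costs the factor
  2^(n-1) but avoids the isodiametric inequality, and the loss is absorbed by the free constant of
  the decay condition. Since the measure is a supremum of contents, coverings at scale 1
  suffice.\<close>

lemma slice_le_hausdorff_measure:
  fixes S :: "(real \<times> 'b::euclidean_space) set"
  assumes "open S"
  shows "ennreal ((1 / 2) ^ DIM('b)) * slice S t \<le> hausdorff_measure DIM('b) (S \<inter> {x. fst x = t})"
proof -
  let ?m = "DIM('b)" and ?S = "S \<inter> {x. fst x = t}"
  let ?c = "ennreal ((1 / 2) ^ ?m)"
  have "?c * slice S t \<le> hausdorff_content ?m 1 ?S"
    unfolding hausdorff_content_def
  proof (rule INF_greatest)
    fix E :: "nat \<Rightarrow> (real \<times> 'b) set"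
    assume "E \<in> {E. ?S \<subseteq> (\<Union>i. E i) \<and> (\<forall>i. bounded (E i) \<and> diameter (E i) \<le> 1)}"
    then have E: "?S \<subseteq> (\<Union>i. E i)" "\<And>i. bounded (E i)" by auto
    define B where "B = (\<lambda>i. if E i = {} then {} else cball (snd (SOME p. p \<in> E i)) (diameter (E
        i)))"
    have EB: "snd q \<in> B i" if "q \<in> E i" for q i
    proof -
      have "(SOME p. p \<in> E i) \<in> E i" using that by (rule someI)
      then have "dist (SOME p. p \<in> E i) q \<le> diameter (E i)"
        using E(2) that by (intro diameter_bounded_bound)
      then show ?thesis
        using that dist_snd_le[of "SOME p. p \<in> E i" q] by (auto simp: B_def)
    qed
    have "{y. (t, y) \<in> S} \<subseteq> (\<Union>i. B i)"
      using E(1) EB by force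
    moreover have meas: "B i \<in> sets lborel" for i by (simp add: B_def)
    ultimately have "slice S t \<le> emeasure lborel (\<Union>i. B i)"
      unfolding slice_def by (intro emeasure_mono) auto
    also have "\<dots> \<le> (\<Sum>i. emeasure lborel (B i))"
      using meas by (intro emeasure_subadditive_countably) auto
    finally have "?c * slice S t \<le> ?c * (\<Sum>i. emeasure lborel (B i))"
      by (rule mult_left_mono) simp
    also have "\<dots> = (\<Sum>i. ?c * emeasure lborel (B i))"
      by (rule ennreal_suminf_cmult[symmetric])
    also have "(\<lambda>i. ?c * emeasure lborel (B i)) = (\<lambda>i. hausdorff_weight ?m (E i))"
    proof
      fix i
      show "?c * emeasure lborel (B i) = hausdorff_weight ?m (E i)"
      proof (cases "E i = {}")
        case False
        have d: "0 \<le> diameter (E i)" using E(2) by (rule diameter_ge_0)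
        have "?c * emeasure lborel (B i) = ?c * ennreal (unit_ball_vol (real ?m) * diameter (E i) ^
            ?m)"
          using False d by (simp add: B_def emeasure_cball)
        also have "\<dots> = hausdorff_weight ?m (E i)"
          using False d by (simp add: hausdorff_weight_def ennreal_mult'[symmetric] power_divide
              mult_ac)
        finally show ?thesis .
      qed (simp add: B_def hausdorff_weight_def)
    qed
    finally show "?c * slice S t \<le> (\<Sum>i. hausdorff_weight ?m (E i))" .
  qed
  also have "\<dots> \<le> hausdorff_measure ?m ?S"
    unfolding hausdorff_measure_def by (rule SUP_upper) simp
  finally show ?thesis .
qed

text \<open>The singularity at the cut is integrable because \<open>\<sigma> < 1\<close>; for
  \<open>\<sigma> = 2 * s\<close> this is where the far interaction needs s < 1/2.\<close>

lemma nn_integral_powr_shift: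
  assumes "0 < \<sigma>" "\<sigma> < 1" "a > 0"
  shows "(\<integral>\<^sup>+t. ennreal ((t - R) powr (- \<sigma>)) * indicator {R<..<R + a} t \<partial>lborel)
      \<le> ennreal (a powr (1 - \<sigma>) / (1 - \<sigma>))"
proof -
  have "(\<integral>\<^sup>+t. ennreal ((t - R) powr (- \<sigma>)) * indicator {R<..<R + a} t \<partial>lborel) =
      (\<integral>\<^sup>+u. ennreal (u powr (- \<sigma>)) * indicator {0<..<a} u \<partial>lborel)"
    by (subst nn_integral_real_affine[where c = 1 and t = R]) (auto simp: indicator_def)
  also have "\<dots> \<le> (\<integral>\<^sup>+u. indicator {0..a} u * ennreal (u powr (- \<sigma>)) \<partial>lborel)"
    by (intro nn_integral_mono) (auto simp: indicator_def)
  also have "\<dots> = (\<integral>\<^sup>+u. ennreal (indicator {0..a} u * (u powr (- \<sigma>))) \<partial>lborel)"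
    by (intro nn_integral_cong) (auto simp: indicator_def)
  also have "\<dots> = ennreal (a powr (- \<sigma> + 1) / (- \<sigma> + 1))"
    using assms by (intro nn_integral_has_integral_lebesgue has_integral_powr_from_0) auto
  finally show ?thesis by (simp add: add.commute)
qed

text \<open>Here \<open>m\<close> stands for the slice function, and the witness \<open>r\<close> is
  one of the \<open>R k\<close>. On the window of length \<open>a\<close> the monotonicity condition
  bounds \<open>m\<close> by \<open>C * h (R k)\<close>, leaving an integrable singularity. Beyond
  it the weight is at most \<open>a powr (- \<sigma>)\<close>, and the tail integrals
  \<open>T k\<close> vanish by dominated convergence with majorant \<open>m\<close>.\<close>

lemma decay_tail_slice:
  fixes m :: "real \<Rightarrow> ennreal" and h :: "real \<Rightarrow> real"
  assumes m[measurable]: "m \<in> borel_measurable borel" and fin: "(\<integral>\<^sup>+t. m t \<partial>lborel) < \<infinity>"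
    and \<sigma>: "0 < \<sigma>" "\<sigma> < 1"
    and C: "C \<ge> 0" "\<And>t. t > 0 \<Longrightarrow> m t \<le> ennreal (C * h t)"
    and a: "a > 0" and R0: "\<And>k. 0 \<le> R k" and R: "filterlim R at_top sequentially"
        and h: "(\<lambda>k. h (R k)) \<longlonglongrightarrow> 0"
    and hmono: "\<And>k \<eta>. 0 \<le> \<eta> \<Longrightarrow> \<eta> < a \<Longrightarrow> h (R k + \<eta>) \<le> h (R k)"
    and \<epsilon>: "0 < (\<epsilon>::ennreal)"
  shows "\<exists>r>M. (\<integral>\<^sup>+t. ennreal ((t - r) powr (- \<sigma>)) * indicator {r<..} t * m t \<partial>lborel) < \<epsilon>"
proof -
  define I where "I = a powr (1 - \<sigma>) / (1 - \<sigma>)"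
  have I: "I \<ge> 0" using \<sigma> by (simp add: I_def)
  define T where "T = (\<lambda>k. \<integral>\<^sup>+t. m t * indicator {R k..} t \<partial>lborel)"
  have bound: "(\<integral>\<^sup>+t. ennreal ((t - R k) powr (- \<sigma>)) * indicator {R k<..} t * m t \<partial>lborel)
      \<le> ennreal (C * h (R k)) * ennreal I + ennreal (a powr (- \<sigma>)) * T k" (is "?L \<le> _") for k
  proof -
    have "ennreal ((t - R k) powr (- \<sigma>)) * indicator {R k<..} t * m t \<le>
        ennreal (C * h (R k)) * (ennreal ((t - R k) powr (- \<sigma>)) * indicator {R k<..<R k + a} t)
        + ennreal (a powr (- \<sigma>)) * (m t * indicator {R k..} t)" for t
    proof -
      consider "t \<le> R k" | "R k < t" "t < R k + a" | "R k + a \<le> t" by linarith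
      then show ?thesis
      proof cases
        case 2
        then have "m t \<le> ennreal (C * h t)" using R0[of k] by (intro C(2)) linarith
        also have "\<dots> \<le> ennreal (C * h (R k))"
          using hmono[of "t - R k" k] 2 C(1) by (intro ennreal_leI mult_left_mono) auto
        finally have "ennreal ((t - R k) powr (- \<sigma>)) * m t
            \<le> ennreal (C * h (R k)) * ennreal ((t - R k) powr (- \<sigma>))"
          by (subst mult.commute) (rule mult_right_mono, auto)
        then show ?thesis using 2 by (simp add: add_increasing2)
      next
        case 3
        have "(t - R k) powr (- \<sigma>) \<le> a powr (- \<sigma>)"
          using 3 a \<sigma> by (intro powr_mono2') auto
        then have "ennreal ((t - R k) powr (- \<sigma>)) * m t \<le> ennreal (a powr (- \<sigma>)) * m t"
          by (intro mult_right_mono ennreal_leI) auto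
        then show ?thesis using 3 a by (simp add: add_increasing)
      qed simp
    qed
    then have "?L \<le> (\<integral>\<^sup>+t. ennreal (C * h (R k)) * (ennreal ((t - R k) powr (- \<sigma>)) * indicator {R
        k<..<R k + a} t)
        + ennreal (a powr (- \<sigma>)) * (m t * indicator {R k..} t) \<partial>lborel)"
      by (intro nn_integral_mono)
    also have "\<dots> = ennreal (C * h (R k)) * (\<integral>\<^sup>+t. ennreal ((t - R k) powr (- \<sigma>)) * indicator {R
        k<..<R k + a} t \<partial>lborel)
        + ennreal (a powr (- \<sigma>)) * T k"
      unfolding T_def by (subst nn_integral_add) (auto simp: nn_integral_cmult)
    also have "\<dots> \<le> ennreal (C * h (R k)) * ennreal I + ennreal (a powr (- \<sigma>)) * T k"
      unfolding I_def using nn_integral_powr_shift[OF \<sigma> a] by (intro add_mono mult_left_mono) auto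
    finally show ?thesis .
  qed
  have T: "T \<longlonglongrightarrow> 0"
  proof -
    have "(\<lambda>k. \<integral>\<^sup>+t. m t * indicator {R k..} t \<partial>lborel) \<longlonglongrightarrow> (\<integral>\<^sup>+t. 0 \<partial>(lborel :: real measure))"
    proof (rule nn_integral_dominated_convergence[where w = m])
      show "AE t in lborel. (\<lambda>k. m t * indicator {R k..} t) \<longlonglongrightarrow> 0"
      proof (rule AE_I2)
        fix t
        have "\<forall>\<^sub>F k in sequentially. t < R k"
          using R by (simp add: filterlim_at_top_dense)
        then have "\<forall>\<^sub>F k in sequentially. 0 = m t * indicator {R k..} t"
          by eventually_elim simp
        then show "(\<lambda>k. m t * indicator {R k..} t) \<longlonglongrightarrow> 0"
          by (rule Lim_transform_eventually[OF tendsto_const])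
      qed
    qed (use fin in \<open>auto simp: indicator_def\<close>)
    then show ?thesis by (simp add: T_def)
  qed
  have "(\<lambda>k. ennreal (C * h (R k)) * ennreal I + ennreal (a powr (- \<sigma>)) * T k) \<longlonglongrightarrow>
      ennreal (C * 0) * ennreal I + ennreal (a powr (- \<sigma>)) * 0"
    by (intro tendsto_add tendsto_mult_ennreal tendsto_ennrealI tendsto_mult tendsto_const h T) auto
  then have "\<forall>\<^sub>F k in sequentially. ennreal (C * h (R k)) * ennreal I
      + ennreal (a powr (- \<sigma>)) * T k < \<epsilon>"
    using \<epsilon> by (intro order_tendstoD(2)) auto
  moreover have "\<forall>\<^sub>F k in sequentially. M < R k"
    using R by (simp add: filterlim_at_top_dense)
  ultimately have "\<forall>\<^sub>F k in sequentially. M < R k \<and> ennreal (C * h (R k)) * ennreal I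
      + ennreal (a powr (- \<sigma>)) * T k < \<epsilon>"
    by eventually_elim simp
  then obtain k where "M < R k" "ennreal (C * h (R k)) * ennreal I
      + ennreal (a powr (- \<sigma>)) * T k < \<epsilon>"
    using eventually_happens'[OF sequentially_bot] by blast
  then show ?thesis using bound[of k] by (intro exI[of _ "R k"]) auto
qed

lemma decay_tail:
  fixes \<Omega> :: "(real \<times> 'b::euclidean_space) set"
  assumes \<Omega>: "open \<Omega>" "emeasure lborel \<Omega> < \<infinity>" and decay: "decay_forward \<Omega>"
    and \<sigma>: "0 < \<sigma>" "\<sigma> < 1" and \<epsilon>: "0 < (\<epsilon>::ennreal)"
  shows "\<exists>r>M. (\<integral>\<^sup>+t. ennreal ((t - r) powr (- \<sigma>)) * indicator {r<..} t * slice \<Omega> t \<partial>lborel) < \<epsilon>"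
proof -
  obtain h C a R where "C \<ge> 0" and H: "\<forall>t>0. hausdorff_measure (DIM(real \<times> 'b) - 1) (\<Omega> \<inter> {x. fst x
      = t}) \<le> ennreal (C * h t)"
    and a: "a > 0" "\<forall>k. 0 \<le> R k" "filterlim R at_top sequentially" "(\<lambda>k. h (R k)) \<longlonglongrightarrow> 0"
     "\<forall>k. \<forall>\<eta> \<in> {0..<a}. h (R k + \<eta>) \<le> h (R k)"
    using decay unfolding decay_forward_def by (elim exE conjE)
  have fin: "(\<integral>\<^sup>+t. slice \<Omega> t \<partial>lborel) < \<infinity>"
    using nn_integral_fst_slice(1)[OF \<Omega>(1), of "\<lambda>_. 1"] \<Omega> by simp
  have "slice \<Omega> t \<le> ennreal (2 ^ DIM('b) * C * h t)" if "t > 0" for t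
  proof -
    have "slice \<Omega> t = ennreal (2 ^ DIM('b)) * (ennreal ((1 / 2) ^ DIM('b)) * slice \<Omega> t)"
      by (simp add: mult.assoc[symmetric] ennreal_mult[symmetric] power_mult_distrib[symmetric] del:
          ennreal_power)
    also have "\<dots> \<le> ennreal (2 ^ DIM('b)) * ennreal (C * h t)"
      using order_trans[OF slice_le_hausdorff_measure[OF \<Omega>(1)] H[rule_format, OF that, simplified]]
      by (intro mult_left_mono) auto
    also have "\<dots> = ennreal (2 ^ DIM('b) * C * h t)"
      by (subst ennreal_mult'[symmetric]) (simp_all add: mult.assoc)
    finally show ?thesis .
  qed
  then show ?thesis
    by (intro decay_tail_slice[OF nn_integral_fst_slice(2)[OF \<Omega>(1)] fin \<sigma>, where C
        = "2 ^ DIM('b) * C" and h = h and a = a and R = R])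
      (use \<open>C \<ge> 0\<close> a \<epsilon> in auto)
qed

lemma slice_reflect: "slice ((\<lambda>(x\<^sub>1, x'). (- x\<^sub>1, x')) ` \<Omega>) t = slice \<Omega> (- t)"
proof -
  have "{y. (t, y) \<in> (\<lambda>(x\<^sub>1, x'). (- x\<^sub>1, x')) ` \<Omega>} = {y. (- t, y) \<in> \<Omega>}"
    by force
  then show ?thesis by (simp add: slice_def)
qed

text \<open>The decay sequences of the two ends are unrelated, so each end gets its own radius. The
  second claim is the first for the mirror image, pulled back through t to -t.\<close>

lemma decay_tails:
  fixes \<Omega> :: "(real \<times> 'b::euclidean_space) set"
  assumes \<Omega>: "open \<Omega>" "emeasure lborel \<Omega> < \<infinity>" and decay: "decay_one_direction \<Omega>"
    and \<sigma>: "0 < \<sigma>" "\<sigma> < 1" and \<epsilon>: "0 < (\<epsilon>::ennreal)"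
  shows "\<exists>r>M. (\<integral>\<^sup>+x. ennreal ((fst x - r) powr (- \<sigma>)) * indicator {r<..} (fst x) * indicator \<Omega> x
      \<partial>lborel) < \<epsilon>"
    and "\<exists>r>M. (\<integral>\<^sup>+x. ennreal ((- fst x - r) powr (- \<sigma>)) * indicator {r<..} (- fst x) * indicator \<Omega>
        x \<partial>lborel) < \<epsilon>"
proof -
  have meas: "(\<lambda>t. ennreal ((t - r) powr (- \<sigma>)) * indicator {r<..} t) \<in> borel_measurable borel"
    "(\<lambda>t. ennreal ((- t - r) powr (- \<sigma>)) * indicator {r<..} (- t)) \<in> borel_measurable borel"
        for r :: real
    by measurable
  show "\<exists>r>M. (\<integral>\<^sup>+x. ennreal ((fst x - r) powr (- \<sigma>)) * indicator {r<..} (fst x) * indicator \<Omega> x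
      \<partial>lborel) < \<epsilon>"
    unfolding nn_integral_fst_slice(1)[OF \<Omega>(1) meas(1)]
    using decay by (intro decay_tail \<Omega> \<sigma> \<epsilon>) (simp add: decay_one_direction_def)
  let ?r = "\<lambda>(x\<^sub>1::real, x'::'b). (- x\<^sub>1, x')"
  have "?r ` \<Omega> = ?r -` \<Omega>" by force
  moreover have "open (?r -` \<Omega>)"
    using \<Omega>(1) by (intro open_vimage) (auto simp: case_prod_beta intro!: continuous_intros)
  ultimately have op: "open (?r ` \<Omega>)" by simp
  note slice_meas = nn_integral_fst_slice(2)[OF op]
  have reflect: "(\<integral>\<^sup>+t. F t * slice (?r ` \<Omega>) t \<partial>lborel) = (\<integral>\<^sup>+t. F (- t) * slice \<Omega> t \<partial>lborel)"
    if "F \<in> borel_measurable borel" for F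
  proof -
    have "(\<lambda>t. slice (?r ` \<Omega>) (- t)) \<in> borel_measurable borel"
      using slice_meas by measurable
    then show ?thesis
      using that slice_meas
      by (subst nn_integral_real_affine[where c = "- 1" and t = 0]) (simp_all add: slice_reflect)
  qed
  \<comment> \<open>Finiteness of the measure of the mirror image, read off from the slices by
    Fubini with the constant weight 1.\<close>
  have "emeasure lborel (?r ` \<Omega>) = emeasure lborel \<Omega>"
    using nn_integral_fst_slice(1)[OF op, of "\<lambda>_. 1"] nn_integral_fst_slice(1)[OF \<Omega>(1), of "\<lambda>_. 1"]
      reflect[of "\<lambda>_. 1"] op \<Omega>(1) by simp
  then have "\<exists>r>M. (\<integral>\<^sup>+t. ennreal ((t - r) powr (- \<sigma>)) * indicator {r<..} t * slice (?r ` \<Omega>) t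
      \<partial>lborel) < \<epsilon>"
    using decay \<Omega>(2) by (intro decay_tail op \<sigma> \<epsilon>) (simp_all add: decay_one_direction_def)
  then show "\<exists>r>M. (\<integral>\<^sup>+x. ennreal ((- fst x - r) powr (- \<sigma>)) * indicator {r<..} (- fst x) *
      indicator \<Omega> x \<partial>lborel) < \<epsilon>"
    unfolding nn_integral_fst_slice(1)[OF \<Omega>(1) meas(2)] reflect[OF meas(1)] .
qed

subsection \<open>Energy of a cutoff\<close>

text \<open>A pointwise majorant of the Gagliardo integrand, as a function of z = x - y, for a
  function with values in [0, 1] and Lipschitz constant \<open>1 / r\<close>. The cap gives
  integrability at infinity, the quadratic factor at the origin.\<close>

definition capped_kernel :: "real \<Rightarrow> real \<Rightarrow> 'a::euclidean_space \<Rightarrow> ennreal" where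
  "capped_kernel s r z = ennreal (min 1 ((norm z / r)\<^sup>2) / norm z powr (real DIM('a) + 2 * s))"

lemma borel_measurable_capped_kernel [measurable]:
  "capped_kernel s r \<in> borel_measurable borel"
  unfolding capped_kernel_def[abs_def] by measurable

lemma nn_integral_lborel_translate:
  fixes f :: "'a::euclidean_space \<Rightarrow> ennreal"
  assumes [measurable]: "f \<in> borel_measurable borel"
  shows "(\<integral>\<^sup>+x. f (x - y) \<partial>lborel) = (\<integral>\<^sup>+x. f x \<partial>lborel)"
proof -
  have "(\<integral>\<^sup>+x. f x \<partial>lborel) = (\<integral>\<^sup>+x. f x \<partial>(distr lborel borel ((+) (- y))))"
    by (simp add: lborel_distr_plus)
  also have "\<dots> = (\<integral>\<^sup>+x. f (x - y) \<partial>lborel)"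
    by (subst nn_integral_distr) auto
  finally show ?thesis ..
qed

text \<open>For complementary sets this is the fractional perimeter of order 2s, up to
  normalisation.\<close>

definition interaction :: "real \<Rightarrow> 'a::euclidean_space set \<Rightarrow> 'a set \<Rightarrow> ennreal" where
  "interaction s A B = (\<integral>\<^sup>+y. indicator B y *
     (\<integral>\<^sup>+x. indicator A x * ennreal (1 / norm (x - y) powr (real DIM('a)
         + 2 * s)) \<partial>lborel) \<partial>lborel)"

text \<open>Away from the layer \<open>N\<close> the cutoff agrees with the indicator of \<open>D\<close>; a pair with a point in
  \<open>N\<close> is charged to the capped kernel.\<close>

lemma cutoff_energy_pointwise:
  fixes \<phi> :: "'a::euclidean_space \<Rightarrow> real"
  assumes \<phi>: "\<And>x. 0 \<le> \<phi> x" "\<And>x. \<phi> x \<le> 1" "\<And>x. x \<notin> N \<Longrightarrow> \<phi> x = indicator D x"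
    and lip: "\<And>x y. \<bar>\<phi> x - \<phi> y\<bar> \<le> norm (x - y) / r" and xy: "x \<in> \<Omega>" "y \<in> \<Omega>"
  shows "ennreal (\<bar>\<phi> x - \<phi> y\<bar>\<^sup>2 / norm (x - y) powr p) \<le>
    indicator (\<Omega> - D) y * (indicator D x * ennreal (1 / norm (x - y) powr p)) +
    indicator (\<Omega> - D) x * (indicator D y * ennreal (1 / norm (y - x) powr p)) +
    (indicator N y + indicator N x) * ennreal (min 1 ((norm (x - y) / r)\<^sup>2) / norm (x - y) powr p)"
proof (cases "x \<in> N \<or> y \<in> N")
  case True
  have "\<bar>\<phi> x - \<phi> y\<bar> \<le> 1" using \<phi>(1,2)[of x] \<phi>(1,2)[of y] by (simp add: abs_le_iff)
  then have "\<bar>\<phi> x - \<phi> y\<bar>\<^sup>2 \<le> min 1 ((norm (x - y) / r)\<^sup>2)"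
    using lip[of x y] power_mono[of "\<bar>\<phi> x - \<phi> y\<bar>" _ 2] by (intro min.boundedI) force+
  then have "ennreal (\<bar>\<phi> x - \<phi> y\<bar>\<^sup>2 / norm (x - y) powr p)
      \<le> ennreal (min 1 ((norm (x - y) / r)\<^sup>2) / norm (x - y) powr p)"
    by (intro ennreal_leI divide_right_mono) auto
  also have "\<dots> \<le> (indicator N y + indicator N x) * ennreal (min 1 ((norm (x - y) / r)\<^sup>2) / norm (x -
      y) powr p)"
    using mult_right_mono[of 1 "indicator N y + indicator N x :: ennreal"] True
    by (auto simp: indicator_def)
  finally show ?thesis by (simp add: add_increasing)
next
  case False
  then show ?thesis
    using \<phi>(3)[of x] \<phi>(3)[of y] xy by (auto simp: indicator_def norm_minus_commute)
qed

text \<open>Both terms of the pointwise bound occur a second time with the variables exchanged;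
  Tonelli identifies the two copies, whence the factors 2. Translation invariance makes the inner
  integral of the capped kernel independent of the point of \<open>N\<close>.\<close>

lemma cutoff_energy_le:
  fixes \<phi> :: "'a::euclidean_space \<Rightarrow> real"
  assumes [measurable]: "\<phi> \<in> borel_measurable borel" "\<Omega> \<in> sets borel" "D \<in> sets borel" "N \<in> sets
      borel"
    and \<phi>: "\<And>x. 0 \<le> \<phi> x" "\<And>x. \<phi> x \<le> 1" "\<And>x. x \<notin> N \<Longrightarrow> \<phi> x = indicator D x"
    and lip: "\<And>x y. \<bar>\<phi> x - \<phi> y\<bar> \<le> norm (x - y) / r"
  shows "(\<integral>\<^sup>+y\<in>\<Omega>. (\<integral>\<^sup>+x\<in>\<Omega>. ennreal (\<bar>\<phi> x - \<phi> y\<bar>\<^sup>2 / norm (x - y) powr (real DIM('a)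
      + 2 * s)) \<partial>lebesgue) \<partial>lebesgue)
    \<le> 2 * interaction s D (\<Omega> - D) + 2 * (emeasure lborel N * (\<integral>\<^sup>+z. capped_kernel s r (z::'a)
        \<partial>lborel))"
proof -
  let ?p = "real DIM('a) + 2 * s"
  let ?k = "\<lambda>x y :: 'a. ennreal (1 / norm (x - y) powr ?p)"
  let ?A = "\<lambda>x y :: 'a. indicator (\<Omega> - D) y * (indicator D x * ?k x y) :: ennreal"
  let ?B = "\<lambda>x y :: 'a. indicator N y * capped_kernel s r (x - y) :: ennreal"
  have twice: "a + a + (b + b) = 2 * a + 2 * b" for a b :: ennreal
    by (simp only: mult_2)
  have mA[measurable]: "(\<lambda>(x, y). ?A x y) \<in> borel_measurable (lborel \<Otimes>\<^sub>M lborel)"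
    by measurable
  have mB[measurable]: "(\<lambda>(x, y). ?B x y) \<in> borel_measurable (lborel \<Otimes>\<^sub>M lborel)"
    by measurable
  have A: "(\<integral>\<^sup>+y. \<integral>\<^sup>+x. ?A x y \<partial>lborel \<partial>lborel) = interaction s D (\<Omega> - D)"
    unfolding interaction_def by (intro nn_integral_cong nn_integral_cmult) measurable
  have B: "(\<integral>\<^sup>+y. \<integral>\<^sup>+x. ?B x y \<partial>lborel \<partial>lborel)
      = emeasure lborel N * (\<integral>\<^sup>+z. capped_kernel s r (z::'a) \<partial>lborel)"
  proof -
    have "(\<integral>\<^sup>+x. ?B x y \<partial>lborel) = (\<integral>\<^sup>+z. capped_kernel s r (z::'a) \<partial>lborel) * indicator N y" for y
      by (simp add: nn_integral_cmult nn_integral_lborel_translate mult.commute)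
    then show ?thesis by (simp add: nn_integral_multc mult.commute)
  qed
  have "(\<integral>\<^sup>+y\<in>\<Omega>. (\<integral>\<^sup>+x\<in>\<Omega>. ennreal (\<bar>\<phi> x - \<phi> y\<bar>\<^sup>2 / norm (x - y) powr ?p) \<partial>lebesgue) \<partial>lebesgue)
     = (\<integral>\<^sup>+y. (\<integral>\<^sup>+x. ennreal (\<bar>\<phi> x - \<phi> y\<bar>\<^sup>2 / norm (x - y) powr ?p) * indicator \<Omega> x \<partial>lborel) *
         indicator \<Omega> y \<partial>lborel)"
    by (simp add: nn_integral_completion)
  also have "\<dots> \<le> (\<integral>\<^sup>+y. \<integral>\<^sup>+x. ?A x y + ?A y x + (?B x y + ?B y x) \<partial>lborel \<partial>lborel)"
  proof (rule nn_integral_mono)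
    fix y :: 'a
    show "(\<integral>\<^sup>+x. ennreal (\<bar>\<phi> x - \<phi> y\<bar>\<^sup>2 / norm (x - y) powr ?p) * indicator \<Omega> x \<partial>lborel) * indicator
        \<Omega> y
        \<le> (\<integral>\<^sup>+x. ?A x y + ?A y x + (?B x y + ?B y x) \<partial>lborel)"
    proof (cases "y \<in> \<Omega>")
      case True
      have "ennreal (\<bar>\<phi> x - \<phi> y\<bar>\<^sup>2 / norm (x - y) powr ?p) * indicator \<Omega> x \<le> ?A x y + ?A y x
          + (?B x y + ?B y x)" for x
      proof (cases "x \<in> \<Omega>")
        case x: True
        show ?thesis
          using cutoff_energy_pointwise[OF \<phi> lip x True, where p = ?p] x
          by (simp add: capped_kernel_def norm_minus_commute[of y x] distrib_right)
      qed simp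
      then show ?thesis using True by (simp add: nn_integral_mono)
    qed simp
  qed
  also have "\<dots> = (\<integral>\<^sup>+y. (\<integral>\<^sup>+x. ?A x y \<partial>lborel) + (\<integral>\<^sup>+x. ?A y x \<partial>lborel)
      + ((\<integral>\<^sup>+x. ?B x y \<partial>lborel) + (\<integral>\<^sup>+x. ?B y x \<partial>lborel)) \<partial>lborel)"
    by (intro nn_integral_cong) (simp add: nn_integral_add)
  also have "\<dots> = (\<integral>\<^sup>+y. \<integral>\<^sup>+x. ?A x y \<partial>lborel \<partial>lborel) + (\<integral>\<^sup>+y. \<integral>\<^sup>+x. ?A y x \<partial>lborel \<partial>lborel)
      + ((\<integral>\<^sup>+y. \<integral>\<^sup>+x. ?B x y \<partial>lborel \<partial>lborel) + (\<integral>\<^sup>+y. \<integral>\<^sup>+x. ?B y x \<partial>lborel \<partial>lborel))"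
    by (simp add: nn_integral_add)
  also have "(\<integral>\<^sup>+y. \<integral>\<^sup>+x. ?A y x \<partial>lborel \<partial>lborel) = (\<integral>\<^sup>+y. \<integral>\<^sup>+x. ?A x y \<partial>lborel \<partial>lborel)"
    by (rule lborel_pair.Fubini'[OF mA, symmetric])
  also have "(\<integral>\<^sup>+y. \<integral>\<^sup>+x. ?B y x \<partial>lborel \<partial>lborel) = (\<integral>\<^sup>+y. \<integral>\<^sup>+x. ?B x y \<partial>lborel \<partial>lborel)"
    by (rule lborel_pair.Fubini'[OF mB, symmetric])
  finally show ?thesis unfolding A B twice .
qed

section \<open>Interaction of the slab with the two ends of the domain\<close>

lemma AE_fst_neq: "AE x in lborel. fst (x :: real \<times> 'b::euclidean_space) \<noteq> c"
proof -
  have eq: "{x :: real \<times> 'b. fst x = c} = {x. (1, 0) \<bullet> x = c}"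
    by (auto simp: inner_prod_def)
  have "negligible {x :: real \<times> 'b. fst x = c}"
    unfolding eq by (rule negligible_hyperplane) (simp add: prod_eq_iff)
  moreover have "closed {x :: real \<times> 'b. fst x = c}"
    by (intro closed_Collect_eq continuous_intros)
  ultimately have "{x :: real \<times> 'b. fst x = c} \<in> null_sets lborel"
    by (simp add: negligible_iff_null_sets null_sets_completion_iff)
  then show ?thesis by (rule AE_I') auto
qed

text \<open>For a point \<open>y\<close> beyond a cut, at distance \<open>r\<close> from it in the
  first coordinate, all points of \<open>D\<close> are at distance at least \<open>r\<close>. There
  the cap equals 1, so the plain kernel is dominated by the capped one and its integral over
  \<open>D\<close> is at most \<open>K * r powr (- 2 * s)\<close>. Points on the cuts themselves
  have r = 0 and are discarded as a null set.\<close>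

lemma interaction_slab_le:
  fixes \<Omega> :: "(real \<times> 'b::euclidean_space) set"
  assumes K: "K \<ge> 0" "\<And>r. r > 0 \<Longrightarrow> (\<integral>\<^sup>+z. capped_kernel s r (z :: real \<times> 'b) \<partial>lborel)
      \<le> ennreal (K * r powr (- 2 * s))"
    and \<Omega>[measurable]: "\<Omega> \<in> sets borel" and D: "D = \<Omega> \<inter> {x. - S < fst x \<and> fst x < R}"
  shows "interaction s D (\<Omega> - D) \<le>
    ennreal K * ((\<integral>\<^sup>+x. ennreal ((fst x - R) powr (- (2 * s))) * indicator {R<..} (fst x) *
        indicator \<Omega> x \<partial>lborel)
      + (\<integral>\<^sup>+x. ennreal ((- fst x - S) powr (- (2 * s))) * indicator {S<..} (- fst x) * indicator \<Omega> x
          \<partial>lborel))"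
proof -
  let ?p = "real DIM(real \<times> 'b) + 2 * s"
  let ?J = "\<lambda>y :: real \<times> 'b. \<integral>\<^sup>+x. indicator D x * ennreal (1 / norm (x - y) powr ?p) \<partial>lborel"
  let ?f = "\<lambda>x :: real \<times> 'b. ennreal ((fst x - R) powr (- (2 * s))) * indicator {R<..} (fst x) *
      indicator \<Omega> x"
  let ?g = "\<lambda>x :: real \<times> 'b. ennreal ((- fst x - S) powr (- (2 * s))) * indicator {S<..} (- fst x) *
      indicator \<Omega> x"
  have J: "?J y \<le> ennreal K * ennreal (r powr (- (2 * s)))" if r: "r > 0" and far: "\<And>x. x \<in> D \<Longrightarrow> r
      \<le> \<bar>fst x - fst y\<bar>" for y r
  proof -
    have "indicator D x * ennreal (1 / norm (x - y) powr ?p) \<le> capped_kernel s r (x - y)" for x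
    proof (cases "x \<in> D")
      case True
      have "r \<le> norm (x - y)"
        using far[OF True] norm_fst_le[of "fst (x - y)" "snd (x - y)"] unfolding prod.collapse
            by simp
      then have "1 \<le> (norm (x - y) / r)\<^sup>2" using r by (simp add: one_le_power)
      then show ?thesis using True by (simp add: capped_kernel_def min_def)
    qed simp
    then have "?J y \<le> (\<integral>\<^sup>+x. capped_kernel s r (x - y) \<partial>lborel)"
      by (intro nn_integral_mono)
    also have "\<dots> \<le> ennreal (K * r powr (- 2 * s))"
      using K(2)[OF r] by (simp add: nn_integral_lborel_translate)
    finally show ?thesis using K(1) by (simp add: ennreal_mult')
  qed
  have "interaction s D (\<Omega> - D) \<le> (\<integral>\<^sup>+y. ennreal K * (?f y + ?g y) \<partial>lborel)"
    unfolding interaction_def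
  proof (rule nn_integral_mono_AE)
    show "AE y in lborel. indicator (\<Omega> - D) y * ?J y \<le> ennreal K * (?f y + ?g y)"
      using AE_fst_neq[of R] AE_fst_neq[of "- S"]
    proof eventually_elim
      fix y :: "real \<times> 'b" assume y: "fst y \<noteq> R" "fst y \<noteq> - S"
      show "indicator (\<Omega> - D) y * ?J y \<le> ennreal K * (?f y + ?g y)"
      proof (cases "y \<in> \<Omega> - D")
        case True
        then consider "fst y > R" | "- fst y > S" using y D by force
        then show ?thesis
        proof cases
          case 1
          then have "?J y \<le> ennreal K * ennreal ((fst y - R) powr (- (2 * s)))"
            by (intro J) (auto simp: D)
          also have "\<dots> \<le> ennreal K * (?f y + ?g y)"
            using True 1 by (intro mult_left_mono) (auto simp: add_increasing2)
          finally show ?thesis using True by simp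
        next
          case 2
          then have "?J y \<le> ennreal K * ennreal ((- fst y - S) powr (- (2 * s)))"
            by (intro J) (auto simp: D)
          also have "\<dots> \<le> ennreal K * (?f y + ?g y)"
            using True 2 by (intro mult_left_mono) (auto simp: add_increasing)
          finally show ?thesis using True by simp
        qed
      qed simp
    qed
  qed
  also have "\<dots> = ennreal K * ((\<integral>\<^sup>+x. ?f x \<partial>lborel) + (\<integral>\<^sup>+x. ?g x \<partial>lborel))"
  proof -
    have [measurable]: "(fst :: real \<times> 'b \<Rightarrow> real) \<in> borel_measurable borel"
      by (intro borel_measurable_continuous_onI continuous_intros)
    have f: "?f \<in> borel_measurable lborel" and g: "?g \<in> borel_measurable lborel"
      unfolding measurable_lborel1 by measurable
    have "(\<integral>\<^sup>+y. ennreal K * (?f y + ?g y) \<partial>lborel) = ennreal K * (\<integral>\<^sup>+y. ?f y + ?g y \<partial>lborel)"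
      by (intro nn_integral_cmult borel_measurable_add f g)
    then show ?thesis by (simp only: nn_integral_add[OF f g])
  qed
  finally show ?thesis .
qed

section \<open>Rayleigh quotients of test functions and the choice of parameters\<close>

lemma test_function_mem_frac_sobolev_0:
  assumes "\<phi> \<in> test_functions \<Omega>"
  shows "\<phi> \<in> frac_sobolev_0 s \<Omega>"
proof -
  have "Ck_function 0 \<phi>" using assms by (auto simp: test_functions_def)
  then have "\<phi> \<in> borel_measurable lebesgue"
    by (simp add: borel_measurable_continuous_onI measurable_completion)
  then have "\<phi> \<in> borel_measurable (lebesgue_on \<Omega>)"
    by (rule measurable_restrict_space1)
  moreover have "frac_sobolev_norm s \<Omega> (\<lambda>x. 0) = 0"
    by (simp add: frac_sobolev_norm_def gagliardo_seminorm_def ennreal_sqrt_def)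
  ultimately show ?thesis
    using assms unfolding frac_sobolev_0_def by (auto intro!: exI[of _ "\<lambda>_. \<phi>"])
qed

lemma poincare_const_le:
  assumes \<phi>: "\<phi> \<in> test_functions \<Omega>" and \<Omega>: "\<Omega> \<in> sets lebesgue" and b: "0 < b"
    and mass: "ennreal b \<le> (\<integral>\<^sup>+x\<in>\<Omega>. ennreal ((\<phi> x)\<^sup>2) \<partial>lebesgue)"
    and energy: "(gagliardo_seminorm s \<Omega> \<phi>)\<^sup>2 \<le> e * ennreal b"
  shows "poincare_const s \<Omega> \<le> e"
proof -
  let ?Y = "\<integral>\<^sup>+x\<in>\<Omega>. ennreal ((\<phi> x)\<^sup>2) \<partial>lebesgue"
  have Y: "0 < ?Y" using mass b by (simp add: less_le_trans[OF _ mass])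
  have "\<not> (AE x in lebesgue_on \<Omega>. \<phi> x = 0)"
  proof
    assume "AE x in lebesgue_on \<Omega>. \<phi> x = 0"
    then have "AE x in lebesgue. x \<in> \<Omega> \<longrightarrow> \<phi> x = 0"
      using \<Omega> by (simp add: AE_restrict_space_iff)
    then have "AE x in lebesgue. ennreal ((\<phi> x)\<^sup>2) * indicator \<Omega> x = 0"
      by eventually_elim (auto simp: indicator_def)
    then have "?Y = (\<integral>\<^sup>+x. 0 \<partial>lebesgue)"
      using nn_integral_cong_AE[of "\<lambda>x. ennreal ((\<phi> x)\<^sup>2) * indicator \<Omega> x" "\<lambda>_. 0" lebesgue] by simp
    then show False using Y by simp
  qed
  then have "poincare_const s \<Omega> \<le> (gagliardo_seminorm s \<Omega> \<phi>)\<^sup>2 / ?Y"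
    unfolding poincare_const_def using test_function_mem_frac_sobolev_0[OF \<phi>]
    by (intro INF_lower2[of \<phi>]) simp_all
  also have "\<dots> \<le> e"
  proof (rule divide_le_posI_ennreal[OF Y])
    have "(gagliardo_seminorm s \<Omega> \<phi>)\<^sup>2 \<le> e * ennreal b" by (rule energy)
    also have "\<dots> \<le> e * ?Y" by (intro mult_left_mono mass) simp
    finally show "(gagliardo_seminorm s \<Omega> \<phi>)\<^sup>2 \<le> ?Y * e" by (simp only: mult.commute)
  qed
  finally show ?thesis .
qed

lemma emeasure_open_pos:
  fixes U :: "'a::euclidean_space set"
  assumes "open U" "U \<noteq> {}"
  shows "0 < emeasure lborel U"
proof -
  have "U \<notin> null_sets lborel"
    using open_not_negligible[OF assms] assms(1)
    by (simp add: negligible_iff_null_sets null_sets_completion_iff)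
  then show ?thesis using assms(1) by (simp add: null_sets_def zero_less_iff_neq_zero)
qed

text \<open>\<open>A * \<delta>\<close> is the measure of the layer and
  \<open>B * \<delta> powr (- 2 * s)\<close> the mass of the capped kernel; their product carries
  the exponent 1 - 2s, which is positive.\<close>

lemma eventually_small_scale:
  fixes A B s \<alpha> \<beta> :: real
  assumes "s < 1 / 2" "0 < \<alpha>" "0 < \<beta>"
  shows "\<exists>\<delta>\<in>{0<..1}. A * \<delta> \<le> \<alpha> \<and> A * \<delta> * (B * \<delta> powr (- 2 * s)) \<le> \<beta>"
proof -
  have t1: "((\<lambda>\<delta>. A * \<delta>) \<longlongrightarrow> A * 0) (at_right 0)"
    by (intro tendsto_intros)
  have "((\<lambda>\<delta>. A * B * \<delta> powr (1 - 2 * s)) \<longlongrightarrow> A * B * 0 powr (1 - 2 * s)) (at_right 0)"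
    using assms(1) by (intro tendsto_mult tendsto_const tendsto_powr2 tendsto_ident_at)
      (auto simp: eventually_at_right_less intro: eventually_mono[OF eventually_at_right_less])
  then have t2: "((\<lambda>\<delta>. A * B * \<delta> powr (1 - 2 * s)) \<longlongrightarrow> 0) (at_right 0)" by simp
  have "\<forall>\<^sub>F \<delta> in at_right 0. A * \<delta> < \<alpha>"
    using order_tendstoD(2)[OF t1] assms(2) by simp
  moreover have "\<forall>\<^sub>F \<delta> in at_right 0. A * B * \<delta> powr (1 - 2 * s) < \<beta>"
    using order_tendstoD(2)[OF t2] assms(3) by simp
  moreover have "\<forall>\<^sub>F \<delta> in at_right (0::real). \<delta> \<in> {0<..<1}"
    by (rule eventually_at_right_real) simp
  ultimately have "\<forall>\<^sub>F \<delta> in at_right 0. A * \<delta> < \<alpha> \<and> A * B * \<delta> powr (1 - 2 * s) < \<beta> \<and> \<delta> \<in> {0<..<1}"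
    by eventually_elim simp
  then obtain \<delta> where "A * \<delta> < \<alpha> \<and> A * B * \<delta> powr (1 - 2 * s) < \<beta> \<and> \<delta> \<in> {0<..<1}"
    using eventually_happens'[OF trivial_limit_at_right_real] by blast
  then have \<delta>: "A * \<delta> < \<alpha>" "A * B * \<delta> powr (1 - 2 * s) < \<beta>" "0 < \<delta>" "\<delta> < 1"
    by simp_all
  have "A * \<delta> * (B * \<delta> powr (- 2 * s)) = A * B * (\<delta> * \<delta> powr (- 2 * s))"
    by (simp only: mult_ac)
  also have "\<delta> * \<delta> powr (- 2 * s) = \<delta> powr (1 - 2 * s)"
    using powr_mult_base[of \<delta> "- 2 * s"] \<delta>(3) by simp
  finally have eq: "A * \<delta> * (B * \<delta> powr (- 2 * s)) = A * B * \<delta> powr (1 - 2 * s)" .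
  show ?thesis
  proof (intro bexI[of _ \<delta>] conjI)
    show "A * \<delta> * (B * \<delta> powr (- 2 * s)) \<le> \<beta>"
      unfolding eq using \<delta>(2) by (rule less_imp_le)
  qed (use \<delta> in auto)
qed

text \<open>A ball is connected, so one that meets both \<open>D\<close> and its complement meets
  the frontier. Hence the points where the cutoff may differ from the indicator of \<open>D\<close>
  lie in the tube.\<close>

lemma mem_tube_frontier:
  fixes x :: "'a::euclidean_space"
  assumes "x \<in> D" "\<not> ball x \<delta> \<subseteq> D"
  shows "x \<in> tube (frontier D) \<delta>"
proof -
  obtain y where y: "y \<in> ball x \<delta>" "y \<notin> D" using assms(2) by blast
  have "0 < \<delta>" using y(1) zero_le_dist[of x y] unfolding mem_ball by linarith
  then have "x \<in> ball x \<delta> \<inter> D" using assms(1) by simp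
  moreover have "y \<in> ball x \<delta> - D" using y by simp
  ultimately have "ball x \<delta> \<inter> frontier D \<noteq> {}"
    using connected_Int_frontier[OF connected_ball[of x \<delta>], of D] by blast
  then show ?thesis by (auto simp: tube_def dist_commute)
qed

text \<open>The lower bound on the mass has to be fixed before \<open>R\<close> and
  \<open>S\<close>, because these depend on \<epsilon> and so on the mass.\<close>

lemma poincare_const_le_pos:
  fixes \<Omega> :: "(real \<times> 'b::euclidean_space) set" and s e :: real
  assumes s: "0 < s" "s < 1 / 2"
    and \<Omega>: "\<Omega> \<noteq> {}" "\<Omega> \<in> lmeasurable" "lipschitz_set \<Omega>"
    and decay: "decay_one_direction \<Omega>"
    and bdd: "\<And>K. K > 0 \<Longrightarrow> bounded (\<Omega> \<inter> {x. \<bar>fst x\<bar> < K})"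
    and e: "0 < e"
  shows "poincare_const s \<Omega> \<le> ennreal e"
proof -
  have op: "open \<Omega>" using \<Omega>(3) by (simp add: lipschitz_set_def)
  have fin: "emeasure lborel \<Omega> < \<infinity>"
    using fmeasurableD2[OF \<Omega>(2)] op by (simp add: less_top)
  have op_slab: "open (\<Omega> \<inter> {x. a < fst x \<and> fst x < b})" for a b
    by (intro open_Int op open_Collect_conj open_Collect_less continuous_intros)
  obtain K where K: "K \<ge> 0" "\<And>r. r > 0 \<Longrightarrow>
      (\<integral>\<^sup>+z. capped_kernel s r (z :: real \<times> 'b) \<partial>lborel) \<le> ennreal (K * r powr (- 2 * s))"
  proof -
    have "s < 1" using s by simp
    from kernel_integral_bound[OF s(1) this, where 'a = "real \<times> 'b", folded capped_kernel_def]
    obtain K where "0 \<le> K" "\<forall>r>0. (\<integral>\<^sup>+z. capped_kernel s r (z :: real \<times> 'b) \<partial>lborel)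
        \<le> ennreal (K * r powr (- 2 * s))"
      by (elim exE conjE)
    then show thesis by (intro that[of K]) blast+
  qed
  obtain Cc where Cc: "Cc > 0" "\<forall>D::(real \<times> 'b) set. \<forall>\<delta>>0. open D \<longrightarrow> bounded D \<longrightarrow>
     (\<exists>\<phi>\<in>test_functions D. (\<forall>x. 0 \<le> \<phi> x \<and> \<phi> x \<le> 1) \<and> (\<forall>x. x \<notin> D \<longrightarrow> \<phi> x = 0) \<and>
        (\<forall>x. ball x \<delta> \<subseteq> D \<longrightarrow> \<phi> x = 1) \<and> (\<forall>x y. \<bar>\<phi> x - \<phi> y\<bar> \<le> Cc * (norm (x - y) / \<delta>)))"
    using smooth_cutoff[where 'a = "real \<times> 'b"] by (elim exE conjE)
  define c where "c = frac_const DIM(real \<times> 'b) s / 2"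
  obtain p where p: "p \<in> \<Omega>" using \<Omega>(1) by blast
  \<comment> \<open>A reference slab around a point of \<open>\<Omega>\<close>. It is contained in
    every admissible \<open>D\<close>, since \<open>R\<close> and \<open>S\<close> will exceed
    \<open>M\<close>, and its measure \<alpha> is positive because its trace on
    \<open>\<Omega>\<close> is open and nonempty.\<close>
  define M where "M = \<bar>fst p\<bar> + 1"
  have "0 < emeasure lborel (\<Omega> \<inter> {x. - M < fst x \<and> fst x < M})"
  proof (rule emeasure_open_pos[OF op_slab])
    have "p \<in> \<Omega> \<inter> {x. - M < fst x \<and> fst x < M}" using p by (auto simp: M_def)
    then show "\<Omega> \<inter> {x. - M < fst x \<and> fst x < M} \<noteq> {}" by blast
  qed
  moreover have "emeasure lborel (\<Omega> \<inter> {x. - M < fst x \<and> fst x < M}) < \<infinity>"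
    using op by (intro le_less_trans[OF emeasure_mono fin]) auto
  ultimately obtain \<alpha> where \<alpha>: "0 < \<alpha>" "emeasure lborel (\<Omega> \<inter> {x. - M < fst x \<and> fst x < M})
      = ennreal \<alpha>"
    by (cases "emeasure lborel (\<Omega> \<inter> {x. - M < fst x \<and> fst x < M})") auto
  \<comment> \<open>The target for the double integral: after multiplication by \<open>c\<close> it
    must stay below \<open>e\<close> times the mass bound \<open>\<alpha> / 2\<close>. Writing
    \<open>\<bar>c\<bar> + 1\<close> keeps the denominator positive whatever the value of
    \<open>c\<close>.\<close>
  define \<eta> where "\<eta> = e * (\<alpha> / 2) / (\<bar>c\<bar> + 1)"
  have \<eta>: "\<eta> > 0" using e \<alpha> by (simp add: \<eta>_def)
  \<comment> \<open>The two tails, counted twice in the energy, contribute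
    \<open>4 * (K * \<epsilon>)\<close>, at most half of \<eta>; the summand 1 covers
    \<open>K = 0\<close>.\<close>
  define \<epsilon> where "\<epsilon> = \<eta> / (8 * (K + 1))"
  have \<epsilon>: "\<epsilon> > 0" using \<eta> K(1) by (simp add: \<epsilon>_def)
  have \<sigma>: "0 < 2 * s" "2 * s < 1" "0 < ennreal \<epsilon>" using s \<epsilon> by auto
  obtain R where R: "M < R" "(\<integral>\<^sup>+x. ennreal ((fst x - R) powr (- (2 * s))) * indicator {R<..} (fst
      x) * indicator \<Omega> x \<partial>lborel) < ennreal \<epsilon>"
    using decay_tails(1)[OF op fin decay \<sigma>] by blast
  obtain S where S: "M < S" "(\<integral>\<^sup>+x. ennreal ((- fst x - S) powr (- (2 * s))) * indicator {S<..} (-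
      fst x) * indicator \<Omega> x \<partial>lborel) < ennreal \<epsilon>"
    using decay_tails(2)[OF op fin decay \<sigma>] by blast
  define D where "D = \<Omega> \<inter> {x. - S < fst x \<and> fst x < R}"
  have D: "open D" unfolding D_def by (rule op_slab)
  have M: "M > 0" by (simp add: M_def)
  have bD: "bounded D"
    using S(1) R(1) M by (intro bounded_subset[OF bdd[of "max S R"]]) (auto simp: D_def)
  have "thin (frontier D)"
    unfolding D_def by (rule thin_frontier_slab[OF \<Omega>(3)]) (use bD in \<open>simp add: D_def\<close>)
  then obtain A where A: "A \<ge> 0" "\<And>\<delta>. \<delta> \<in> {0<..1} \<Longrightarrow> emeasure lborel (tube (frontier D) \<delta>)
      \<le> ennreal (A * \<delta>)"
    unfolding thin_def by blast
  \<comment> \<open>The first bound sacrifices at most half of the reference mass to the layer; the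
    second, counted twice in the energy, uses the other half of \<eta>. The factor
    \<open>Cc powr (2 * s)\<close> arises because the cutoff has Lipschitz constant
    \<open>Cc / \<delta>\<close>, so that the kernel is capped at radius
    \<open>\<delta> / Cc\<close>.\<close>
  obtain \<delta> where \<delta>: "\<delta> \<in> {0<..1}" "A * \<delta> \<le> \<alpha> / 2" "A * \<delta> * (K * Cc powr (2 * s) * \<delta> powr (- 2 * s))
      \<le> \<eta> / 4"
    using eventually_small_scale[of s "\<alpha> / 2" "\<eta> / 4" A "K * Cc powr (2 * s)"] s \<alpha> \<eta> by auto
  have \<delta>0: "\<delta> > 0" using \<delta>(1) by simp
  obtain \<phi> where \<phi>_test: "\<phi> \<in> test_functions D"
    and \<phi>_props: "(\<forall>x. 0 \<le> \<phi> x \<and> \<phi> x \<le> 1) \<and> (\<forall>x. x \<notin> D \<longrightarrow> \<phi> x = 0) \<and>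
        (\<forall>x. ball x \<delta> \<subseteq> D \<longrightarrow> \<phi> x = 1) \<and> (\<forall>x y. \<bar>\<phi> x - \<phi> y\<bar> \<le> Cc * (norm (x - y) / \<delta>))"
    using Cc(2)[rule_format, OF \<delta>0 D bD] by (elim bexE)
  have \<phi>: "0 \<le> \<phi> x" "\<phi> x \<le> 1" "x \<notin> D \<Longrightarrow> \<phi> x = 0" "ball x \<delta> \<subseteq> D \<Longrightarrow> \<phi> x = 1"
      "\<bar>\<phi> x - \<phi> y\<bar> \<le> Cc * (norm (x - y) / \<delta>)" for x y
    using \<phi>_props by blast+
  define N where "N = tube (frontier D) \<delta>"
  have N: "N \<in> sets borel" "emeasure lborel N \<le> ennreal (A * \<delta>)"
    using A(2)[OF \<delta>(1)] by (simp_all add: N_def borel_open)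
  have \<phi>N: "\<phi> x = indicator D x" if "x \<notin> N" for x
    using \<phi>(3,4)[of x] mem_tube_frontier[of x D \<delta>] that by (auto simp: N_def indicator_def)
  have D\<Omega>: "D \<subseteq> \<Omega>" by (auto simp: D_def)
  have \<phi>\<Omega>: "\<phi> \<in> test_functions \<Omega>"
    using \<phi>_test D\<Omega> by (auto simp: test_functions_def)
  have "Ck_function 0 \<phi>" using \<phi>_test by (auto simp: test_functions_def)
  then have \<phi>_meas: "\<phi> \<in> borel_measurable borel"
    by (simp add: borel_measurable_continuous_onI)
  have mass: "ennreal (\<alpha> / 2) \<le> (\<integral>\<^sup>+x\<in>\<Omega>. ennreal ((\<phi> x)\<^sup>2) \<partial>lebesgue)"
  proof -
    have "ennreal \<alpha> \<le> emeasure lborel D"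
      unfolding \<alpha>(2)[symmetric] using R(1) S(1) D by (intro emeasure_mono) (auto simp: D_def)
    also have "\<dots> \<le> emeasure lborel ((D - N) \<union> N)"
      using D N(1) by (intro emeasure_mono) auto
    also have "\<dots> \<le> emeasure lborel (D - N) + emeasure lborel N"
      using D N(1) by (intro emeasure_subadditive) auto
    also have "\<dots> \<le> emeasure lborel (D - N) + ennreal (\<alpha> / 2)"
      using N(2) \<delta>(2) by (intro add_left_mono order_trans[OF N(2) ennreal_leI])
    finally have "ennreal (\<alpha> / 2) + ennreal (\<alpha> / 2) \<le> emeasure lborel (D - N) + ennreal (\<alpha> / 2)"
      using \<alpha>(1) by (simp add: ennreal_plus[symmetric] del: ennreal_plus)
    then have "ennreal (\<alpha> / 2) \<le> emeasure lborel (D - N)"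
      by (simp add: add.commute ennreal_add_left_cancel_le)
    also have "\<dots> = (\<integral>\<^sup>+x. indicator (D - N) x \<partial>lborel)"
      using D N(1) by (subst nn_integral_indicator) auto
    also have "\<dots> \<le> (\<integral>\<^sup>+x. ennreal ((\<phi> x)\<^sup>2) * indicator \<Omega> x \<partial>lborel)"
      using \<phi>N D\<Omega> by (intro nn_integral_mono) (auto simp: indicator_def)
    finally show ?thesis by (simp add: nn_integral_completion)
  qed
  have energy: "(\<integral>\<^sup>+y\<in>\<Omega>. (\<integral>\<^sup>+x\<in>\<Omega>. ennreal (\<bar>\<phi> x - \<phi> y\<bar>\<^sup>2 / norm (x - y) powr (real DIM(real \<times> 'b)
      + 2 * s)) \<partial>lebesgue) \<partial>lebesgue) \<le> ennreal \<eta>"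
    (is "?E \<le> _")
  proof -
    have "?E \<le> 2 * interaction s D (\<Omega> - D)
        + 2 * (emeasure lborel N * (\<integral>\<^sup>+z. capped_kernel s (\<delta> / Cc) (z :: real \<times> 'b) \<partial>lborel))"
    proof (rule cutoff_energy_le[OF \<phi>_meas _ _ N(1) \<phi>(1,2) \<phi>N])
      show "\<bar>\<phi> x - \<phi> y\<bar> \<le> norm (x - y) / (\<delta> / Cc)" for x y
        using \<phi>(5)[of x y] by (simp add: mult.commute)
    qed (use op D in auto)
    also have "\<dots> \<le> 2 * (ennreal K * (ennreal \<epsilon> + ennreal \<epsilon>))
        + 2 * (ennreal (A * \<delta>) * ennreal (K * (\<delta> / Cc) powr (- 2 * s)))"
    proof (intro add_mono mult_left_mono mult_mono N(2) K(2))
      show "interaction s D (\<Omega> - D) \<le> ennreal K * (ennreal \<epsilon> + ennreal \<epsilon>)"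
      proof (rule order_trans[OF interaction_slab_le[OF K(1) _ _ D_def]])
        show "(\<integral>\<^sup>+z. capped_kernel s r (z :: real \<times> 'b) \<partial>lborel) \<le> ennreal (K * r powr (- 2 * s))"
            if "r > 0" for r
          using K(2)[OF that] .
        show "ennreal K * ((\<integral>\<^sup>+x. ennreal ((fst x - R) powr (- (2 * s))) * indicator {R<..} (fst x)
            * indicator \<Omega> x \<partial>lborel)
            + (\<integral>\<^sup>+x. ennreal ((- fst x - S) powr (- (2 * s))) * indicator {S<..} (- fst x) *
                indicator \<Omega> x \<partial>lborel))
          \<le> ennreal K * (ennreal \<epsilon> + ennreal \<epsilon>)"
          by (intro mult_left_mono add_mono less_imp_le[OF R(2)] less_imp_le[OF S(2)]) simp
      qed (use op in simp)
    qed (use \<delta>0 Cc(1) in auto)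
    also have "\<dots> = ennreal (4 * (K * \<epsilon>) + 2 * (A * \<delta> * (K * (\<delta> / Cc) powr (- 2 * s))))"
    proof -
      have two: "2 * ennreal x = ennreal (2 * x)" for x
        by (simp add: ennreal_mult')
      have a: "ennreal K * (ennreal \<epsilon> + ennreal \<epsilon>) = ennreal (K * (\<epsilon> + \<epsilon>))"
        using K(1) \<epsilon> by (simp only: ennreal_plus[symmetric] ennreal_mult'[symmetric] less_imp_le)
      have b: "ennreal (A * \<delta>) * ennreal (K * (\<delta> / Cc) powr (- 2 * s))
          = ennreal (A * \<delta> * (K * (\<delta> / Cc) powr (- 2 * s)))"
        using A(1) \<delta>0 by (intro ennreal_mult'[symmetric]) simp
      have c: "ennreal (2 * (K * (\<epsilon> + \<epsilon>))) + ennreal (2 * (A * \<delta> * (K * (\<delta> / Cc) powr (- 2 * s))))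
          = ennreal (2 * (K * (\<epsilon> + \<epsilon>)) + 2 * (A * \<delta> * (K * (\<delta> / Cc) powr (- 2 * s))))"
        using K(1) A(1) \<delta>0 \<epsilon> by (intro ennreal_plus[symmetric]) auto
      have d: "4 * (K * \<epsilon>) = 2 * (K * (\<epsilon> + \<epsilon>))" by simp
      show ?thesis unfolding a b two c d ..
    qed
    also have "\<dots> \<le> ennreal \<eta>"
    proof (rule ennreal_leI)
      have "8 * (K + 1) * \<epsilon> = \<eta>" using K(1) by (simp add: \<epsilon>_def)
      moreover have "8 * (K + 1) * \<epsilon> = 8 * (K * \<epsilon>) + 8 * \<epsilon>"
          by (simp add: distrib_right distrib_left)
      ultimately have 1: "K * \<epsilon> \<le> \<eta> / 8" using \<epsilon> by linarith
      have "(\<delta> / Cc) powr (- 2 * s) = Cc powr (2 * s) * \<delta> powr (- 2 * s)"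
        using \<delta>0 Cc(1) by (simp add: powr_divide powr_minus_divide)
      then have "A * \<delta> * (K * (\<delta> / Cc) powr (- 2 * s)) \<le> \<eta> / 4"
        using \<delta>(3) by (simp add: mult.assoc)
      with 1 show "4 * (K * \<epsilon>) + 2 * (A * \<delta> * (K * (\<delta> / Cc) powr (- 2 * s))) \<le> \<eta>"
        by linarith
    qed
    finally show ?thesis .
  qed
  show ?thesis
  proof (rule poincare_const_le[OF \<phi>\<Omega> _ _ mass])
    have "(gagliardo_seminorm s \<Omega> \<phi>)\<^sup>2 = ennreal c * ?E"
      by (simp only: gagliardo_seminorm_def ennreal_sqrt_power2 c_def)
    also have "\<dots> \<le> ennreal c * ennreal \<eta>"
      using energy by (rule mult_left_mono) simp
    also have "\<dots> \<le> ennreal \<bar>c\<bar> * ennreal \<eta>"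
      by (intro mult_right_mono ennreal_leI) auto
    also have "\<dots> = ennreal (\<bar>c\<bar> * \<eta>)"
      by (simp add: ennreal_mult')
    also have "\<dots> \<le> ennreal (e * (\<alpha> / 2))"
    proof (rule ennreal_leI)
      have "\<bar>c\<bar> * \<eta> \<le> (\<bar>c\<bar> + 1) * \<eta>" using \<eta> by simp
      also have "\<dots> = e * (\<alpha> / 2)"
      proof -
        have "\<bar>c\<bar> + 1 \<noteq> 0" by linarith
        then show ?thesis using \<eta>_def by (metis nonzero_eq_divide_eq mult.commute)
      qed
      finally show "\<bar>c\<bar> * \<eta> \<le> e * (\<alpha> / 2)" .
    qed
    also have "\<dots> = ennreal e * ennreal (\<alpha> / 2)"
      using e \<alpha>(1) by (subst ennreal_mult) auto
    finally show "(gagliardo_seminorm s \<Omega> \<phi>)\<^sup>2 \<le> ennreal e * ennreal (\<alpha> / 2)" .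
  qed (use op \<alpha>(1) in auto)
qed

text \<open>The condition n >= 2 is carried by the type: \<open>real ^ 'm\<close> has dimension at
  least 1. The value 0 follows from the bounds by arbitrary positive \<open>e\<close>.\<close>

theorem theorem5p6:
  fixes \<Omega> :: "(real \<times> (real ^ 'm)) set" and s :: real
  assumes "0 < s" and "s < 1 / 2"
    and "\<Omega> \<noteq> {}"
    and "\<Omega> \<in> lmeasurable"
    and "lipschitz_set \<Omega>"
    and "decay_one_direction \<Omega>"
    and "\<And>K. K > 0 \<Longrightarrow> bounded (\<Omega> \<inter> {x. \<bar>fst x\<bar> < K})"
  shows "poincare_const s \<Omega> = 0"
proof -
  have "poincare_const s \<Omega> \<le> 0 + ennreal e" if "0 < e" for e
    using poincare_const_le_pos[OF assms that] by simp
  then have "poincare_const s \<Omega> \<le> 0"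
    by (rule ennreal_le_epsilon)
  then show ?thesis by simp
qed

end
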